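(* Let $m>n\ge 1$, $A\in\mathbb{R}^{m\times n}$, $b\in\mathbb{R}^m$ satisfy $0<\sigma_{n+1}<\hat\sigma_n$, let $x$ be the TLS solution, and put $\alpha=\frac{1}{\sqrt{1+\|x\|^2}}$ and $s_n=\frac{\sqrt{\sigma_n^2+\sigma_{n+1}^2}}{\sigma_n^2-\sigma_{n+1}^2}$. Then $$\underline{\kappa}:=\alpha^{-1}s_n\le\kappa_g(A,b)\le\bar{\kappa}:=\alpha^{-2}s_n.$$ Moreover, if $\frac12<\alpha<1$, then $\underline{\kappa}<\bar{\kappa}<4\underline{\kappa}$.
   Context: $\|\cdot\|$ is the Euclidean norm for vectors and the spectral norm for matrices; $\|\cdot\|_F$ is the Frobenius norm. $\hat\sigma_1\ge\cdots\ge\hat\sigma_n$ are the singular values of $A$ and $\sigma_1\ge\cdots\ge\sigma_{n+1}$ are the singular values of $[A\ \,b]\in\mathbb{R}^{m\times(n+1)}$. The total least squares (TLS) problem is $\min\|[E\ \,r]\|_F$ subject to $b-r\in\mathcal{R}(A+E)$ ($\mathcal R$ = range); under $\sigma_{n+1}<\hat\sigma_n$ its unique solution is $x=(A^TA-\sigma_{n+1}^2I_n)^{-1}A^Tb$. Absolute condition number: for $(\tilde A,\tilde b)$ in a small neighbourhood of $(A,b)$, let $\tilde\sigma_{n+1}$ be the smallest singular value of $[\tilde A\ \,\tilde b]$ and let $g:\mathbb{R}^{m(n+1)}\to\mathbb{R}^n$ be the map $[\mathrm{vec}(\tilde A)^T,\tilde b^T]^T\mapsto(\tilde A^T\tilde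 A-\tilde\sigma_{n+1}^2I_n)^{-1}\tilde A^T\tilde b$, i.e. the TLS solution map, where $\mathrm{vec}$ stacks columns. Then $\kappa_g(A,b):=\|g'([\mathrm{vec}(A)^T,b^T]^T)\|$, the spectral norm of the derivative of $g$ at $(A,b)$. *)

theory Defs
  imports "HOL-Analysis.Analysis" "HOL-Library.Multiset"
begin

section \<open>Singular values\<close>

definition eigenvalues :: "real^'n^'n \<Rightarrow> real set" where
  "eigenvalues G = {l. \<exists>v. v \<noteq> 0 \<and> G *v v = l *\<^sub>R v}"

definition eigenspace :: "real^'n^'n \<Rightarrow> real \<Rightarrow> (real^'n) set" where
  "eigenspace G l = {v. G *v v = l *\<^sub>R v}"

text \<open>Singular values with multiplicity, in non-increasing order: square roots of the
  eigenvalues of the Gram matrix. The Gram matrix is symmetric, so geometric and algebraic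
  multiplicities agree. An \<open>m \<times> k\<close> matrix has \<open>min m k\<close> singular values; if \<open>m < k\<close>, the
  truncation discards the surplus zero eigenvalues of the Gram matrix.\<close>

definition singular_values :: "real^'n^'m \<Rightarrow> real list" where
  "singular_values M =
     (let G = transpose M ** M in
      take (min CARD('m) CARD('n))
        (rev (sorted_list_of_multiset
          (\<Sum>l\<in>eigenvalues G. replicate_mset (dim (eigenspace G l)) (sqrt l)))))"

text \<open>Indices start at 1, so \<open>singular_value M 1\<close> is the largest one.\<close>

definition singular_value :: "real^'n^'m \<Rightarrow> nat \<Rightarrow> real" where
  "singular_value M k = singular_values M ! (k - 1)"


section \<open>Total least squares\<close>

text \<open>The matrix \<open>[A b]\<close>; the extra column has index \<open>None\<close>. The library norm on
  \<open>real^'n^'m\<close> is the Frobenius norm.\<close>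

definition augment :: "real^'n^'m \<Rightarrow> real^'m \<Rightarrow> real^('n option)^'m" where
  "augment A b = (\<chi> i j. case j of None \<Rightarrow> b $ i | Some k \<Rightarrow> A $ i $ k)"

definition tls_feasible ::
    "real^'n^'m \<Rightarrow> real^'m \<Rightarrow> real^'n^'m \<Rightarrow> real^'m \<Rightarrow> bool" where
  "tls_feasible A b E r \<longleftrightarrow> b - r \<in> range (\<lambda>x. (A + E) *v x)"

definition tls_minimizer ::
    "real^'n^'m \<Rightarrow> real^'m \<Rightarrow> real^'n^'m \<Rightarrow> real^'m \<Rightarrow> bool" where
  "tls_minimizer A b E r \<longleftrightarrow> tls_feasible A b E r \<and>
     (\<forall>E' r'. tls_feasible A b E' r' \<longrightarrow> norm (augment E r) \<le> norm (augment E' r'))"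

definition tls_solution :: "real^'n^'m \<Rightarrow> real^'m \<Rightarrow> real^'n \<Rightarrow> bool" where
  "tls_solution A b x \<longleftrightarrow> (\<exists>E r. tls_minimizer A b E r \<and> (A + E) *v x = b - r)"


section \<open>The TLS solution map and its condition number\<close>

text \<open>The data space is the product \<open>(real^'n^'m) \<times> (real^'m)\<close>, whose norm
  \<open>sqrt (norm A ^ 2 + norm b ^ 2)\<close> is the Euclidean norm of the stacked vector
  \<open>[vec(A)^T, b^T]^T\<close>.\<close>

definition tls_map :: "(real^'n^'m) \<times> (real^'m) \<Rightarrow> real^'n" where
  "tls_map = (\<lambda>(A, b).
     matrix_inv (transpose A ** A
        - (singular_value (augment A b) (CARD('n) + 1))\<^sup>2 *\<^sub>R mat 1)
     *v (transpose A *v b))"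

definition tls_cond :: "real^'n^'m \<Rightarrow> real^'m \<Rightarrow> real" where
  "tls_cond A b = onorm (frechet_derivative tls_map (at (A, b)))"

end

theory Submission
  imports Defs
begin

text \<open>
  Put \<open>C = [A b]\<close>, \<open>\<lambda> = \<sigma>\<^sub>n\<^sub>+\<^sub>1\<^sup>2\<close> and \<open>r = A x - b\<close>. The smallest eigenvalue \<open>\<lambda>\<close> of \<open>C\<^sup>T C\<close> is simple with
  eigenvector \<open>v = (x, -1)\<close>, and it is the minimum over \<open>y\<close> of \<open>\<bar>A y - b\<bar>\<^sup>2 / (1 + \<bar>y\<bar>\<^sup>2)\<close>, attained
  at \<open>x\<close>. Comparing the quotients of nearby data at \<open>x\<close> and at the perturbed solution differentiates
  \<open>\<lambda>\<close>; the equation \<open>(A\<^sup>T A - \<lambda>) x = A\<^sup>T b\<close> then yields the derivative of the solution map.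

  With \<open>M = A\<^sup>T A - \<lambda>\<close>, the adjoint of the derivative at \<open>M u\<close> has squared norm
  \<open>\<alpha>\<^sup>-\<^sup>2 (\<bar>C p\<bar>\<^sup>2 + \<lambda> \<bar>p\<bar>\<^sup>2)\<close>, where \<open>p\<close> is the projection of \<open>(u, 0)\<close> to the complement of \<open>v\<close>,
  while \<open>(C\<^sup>T C - \<lambda>) p = (M u, x \<bullet> M u)\<close> has norm between \<open>\<bar>M u\<bar>\<close> and \<open>\<alpha>\<^sup>-\<^sup>1 \<bar>M u\<bar>\<close>. The quotient
  \<open>(\<bar>C p\<bar>\<^sup>2 + \<lambda> \<bar>p\<bar>\<^sup>2) / \<bar>(C\<^sup>T C - \<lambda>) p\<bar>\<^sup>2\<close> has maximum \<open>s\<^sub>n\<^sup>2\<close>, attained at an eigenvector for \<open>\<sigma>\<^sub>n\<^sup>2\<close>.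
\<close>

section \<open>Orthonormal eigenbases of self-adjoint maps\<close>

text \<open>First-order optimality. The form \<open>f y \<bullet> y - l * (y \<bullet> y)\<close> is
  nonnegative on \<open>S\<close> and vanishes at \<open>w\<close>, while moving from
  \<open>w\<close> by \<open>- e *\<^sub>R z\<close> with \<open>z = f w - l *\<^sub>R w\<close>
  changes it by \<open>- 2 * e * (z \<bullet> z)\<close> to first order; hence
  \<open>z = 0\<close>.\<close>

lemma rayleigh_minimizer_eigenvector:
  fixes f :: "'a::real_inner \<Rightarrow> 'a"
  assumes lin: "linear f" and self_adj: "\<And>x y. f x \<bullet> y = x \<bullet> f y"
    and S: "subspace S" "w \<in> S" "f w \<in> S"
    and lower: "\<And>y. y \<in> S \<Longrightarrow> l * (y \<bullet> y) \<le> f y \<bullet> y"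
    and attained: "f w \<bullet> w = l * (w \<bullet> w)"
  shows "f w = l *\<^sub>R w"
proof -
  define z where "z = f w - l *\<^sub>R w"
  define c where "c = f z \<bullet> z - l * (z \<bullet> z)"
  have zS: "z \<in> S"
    unfolding z_def by (intro subspace_diff subspace_scale S)
  have c: "c \<ge> 0"
    using lower[OF zS] by (simp add: c_def)
  have key: "2 * (z \<bullet> z) * e \<le> e\<^sup>2 * c" for e
  proof -
    have "w - e *\<^sub>R z \<in> S"
      by (intro subspace_diff subspace_scale S zS)
    then have "0 \<le> f (w - e *\<^sub>R z) \<bullet> (w - e *\<^sub>R z) - l * ((w - e *\<^sub>R z) \<bullet> (w - e *\<^sub>R z))"
      using lower by simp
    also have "\<dots> = (f w \<bullet> w - l * (w \<bullet> w)) - e * (f w \<bullet> z - l * (w \<bullet> z))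
        - e * (f z \<bullet> w - l * (w \<bullet> z)) + e\<^sup>2 * c"
      by (simp add: linear_diff[OF lin] linear_scale[OF lin] inner_diff_left inner_diff_right
          c_def algebra_simps power2_eq_square inner_commute)
    also have "f z \<bullet> w = f w \<bullet> z"
      by (metis self_adj inner_commute)
    also have "f w \<bullet> z - l * (w \<bullet> z) = z \<bullet> z"
      by (subst (3) z_def) (simp add: inner_diff_left)
    finally show ?thesis
      using attained by (simp add: mult_ac)
  qed
  have "z \<bullet> z = 0"
  proof (rule ccontr)
    assume "z \<bullet> z \<noteq> 0"
    then have pos: "z \<bullet> z > 0"
      by simp
    \<comment> \<open>Small enough that \<open>e * c\<close> stays below
      \<open>2 * (z \<bullet> z)\<close>; the \<open>+ 1\<close> covers
      \<open>c = 0\<close>.\<close>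
    define e where "e = (z \<bullet> z) / (c + 1)"
    have e: "e > 0" using pos c by (simp add: e_def)
    have "2 * (z \<bullet> z) \<le> e * c"
      using key[of e] e by (simp add: power2_eq_square mult.assoc)
    also have "e * c \<le> z \<bullet> z"
      using pos c by (simp add: e_def field_simps)
    finally show False using pos by simp
  qed
  then show ?thesis
    by (simp add: z_def)
qed

text \<open>Spectral theorem by induction on the number of eigenvectors: the complement of those
  already found is invariant, and a minimizer of \<open>f y \<bullet> y\<close> on its unit sphere
  is the next one.\<close>

lemma self_adjoint_orthonormal_eigenvectors:
  fixes f :: "'a::euclidean_space \<Rightarrow> 'a"
  assumes lin: "linear f" and self_adj: "\<And>x y. f x \<bullet> y = x \<bullet> f y"
    and "k \<le> DIM('a)"
  shows "\<exists>B. finite B \<and> card B = k \<and> pairwise orthogonal B \<and> (\<forall>b\<in>B. norm b = 1 \<and> (\<exists>l. f b = l *\<^sub>R b))"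
  using \<open>k \<le> DIM('a)\<close>
proof (induction k)
  case 0
  show ?case by (intro exI[of _ "{}"]) (simp add: pairwise_def)
next
  case (Suc k)
  then obtain B where B: "finite B" "card B = k" "pairwise orthogonal B"
      "\<And>b. b \<in> B \<Longrightarrow> norm b = 1" "\<And>b. b \<in> B \<Longrightarrow> \<exists>l. f b = l *\<^sub>R b"
    by auto
  define S where "S = {y. \<forall>b\<in>B. orthogonal b y}"
  have S: "subspace S"
    unfolding S_def by (rule subspace_orthogonal_to_vectors)
  have fS: "f y \<in> S" if "y \<in> S" for y
    unfolding S_def
  proof (clarsimp simp: orthogonal_def)
    fix b assume b: "b \<in> B"
    then obtain l where "f b = l *\<^sub>R b" using B by blast
    moreover have "b \<bullet> y = 0" using that b by (simp add: S_def orthogonal_def)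
    ultimately show "b \<bullet> f y = 0" by (simp flip: self_adj)
  qed
  have "dim B \<le> k"
    using B dim_le_card' by blast
  then have "dim B < DIM('a)"
    using Suc.prems by simp
  then obtain u where u: "u \<noteq> 0" "\<And>y. y \<in> span B \<Longrightarrow> orthogonal u y"
    using orthogonal_to_subspace_exists by blast
  then have uS: "u \<in> S"
    by (auto simp: S_def span_base orthogonal_commute)
  define K where "K = S \<inter> sphere 0 1"
  have "compact K"
    unfolding K_def by (simp add: closed_Int_compact closed_subspace[OF S])
  moreover have "(1 / norm u) *\<^sub>R u \<in> K"
    using u(1) subspace_scale[OF S uS] by (simp add: K_def)
  then have "K \<noteq> {}" by blast
  moreover have "continuous_on K (\<lambda>y. f y \<bullet> y)"
    by (intro continuous_intros linear_continuous_on_compose[OF _ lin])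
  ultimately obtain w where w: "w \<in> K" "\<And>y. y \<in> K \<Longrightarrow> f w \<bullet> w \<le> f y \<bullet> y"
    using continuous_attains_inf[of K "\<lambda>y. f y \<bullet> y"] by blast
  have w1: "norm w = 1" and wS: "w \<in> S"
    using w(1) by (auto simp: K_def)
  have ww: "w \<bullet> w = 1"
    using w1 by (simp add: norm_eq_1)
  have "f w = (f w \<bullet> w) *\<^sub>R w"
  proof (rule rayleigh_minimizer_eigenvector[OF lin self_adj S wS fS[OF wS]])
    fix y assume y: "y \<in> S"
    show "(f w \<bullet> w) * (y \<bullet> y) \<le> f y \<bullet> y"
    proof (cases "y = 0")
      case True
      then show ?thesis by simp
    next
      case False
      then have "(1 / norm y) *\<^sub>R y \<in> K"
        using subspace_scale[OF S y] by (simp add: K_def)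
      from w(2)[OF this] have "f w \<bullet> w \<le> (f y \<bullet> y) / (norm y)\<^sup>2"
        by (simp add: linear_scale[OF lin] power2_eq_square)
      then show ?thesis
        using False by (simp add: field_simps power2_norm_eq_inner)
    qed
  qed (simp add: ww)
  moreover have "w \<notin> B"
    using wS ww by (auto simp: S_def orthogonal_def)
  moreover have "pairwise orthogonal (insert w B)"
    using B(3) wS by (auto simp: S_def pairwise_insert orthogonal_commute)
  ultimately show ?case
    using B w1 by (intro exI[of _ "insert w B"]) auto
qed

lemma self_adjoint_eigenbasis:
  fixes f :: "'a::euclidean_space \<Rightarrow> 'a"
  assumes lin: "linear f" and self_adj: "\<And>x y. f x \<bullet> y = x \<bullet> f y"
  obtains B l where "finite B" "card B = DIM('a)" "pairwise orthogonal B" "span B = UNIV"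
    "\<And>b. b \<in> B \<Longrightarrow> norm b = 1" "\<And>b. b \<in> B \<Longrightarrow> f b = l b *\<^sub>R b"
proof -
  obtain B where B: "finite B" "card B = DIM('a)" "pairwise orthogonal B"
      "\<And>b. b \<in> B \<Longrightarrow> norm b = 1" "\<And>b. b \<in> B \<Longrightarrow> \<exists>l. f b = l *\<^sub>R b"
    using self_adjoint_orthonormal_eigenvectors[OF assms order_refl] by auto
  obtain l where "\<And>b. b \<in> B \<Longrightarrow> f b = l b *\<^sub>R b"
    using B(5) by metis
  moreover have "0 \<notin> B"
    using B(4) by force
  then have "independent B"
    by (rule pairwise_orthogonal_independent[OF B(3)])
  then have "span B = UNIV"
    using B(2) by (metis dim_eq_card_independent dim_eq_full)
  ultimately show ?thesis
    using that B by blast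
qed

section \<open>Singular values\<close>

lemma inner_gram: "(transpose N ** N *v x) \<bullet> y = (N *v x) \<bullet> (N *v y)"
  for N :: "real^'k^'m"
  by (metis dot_lmul_matrix inner_commute matrix_vector_mul_assoc transpose_matrix_vector)

lemma sum_single_mset_const: "finite S \<Longrightarrow> (\<Sum>b\<in>S. {#c#}) = replicate_mset (card S) c"
  by (induction rule: finite_induct) auto

text \<open>Ties the multiset in \<open>singular_values\<close> to an orthonormal basis
  \<open>B\<close>. Each eigenspace is the span of the basis vectors with that eigenvalue, so its
  dimension counts them, and the sum over eigenvalues regroups into one over
  \<open>B\<close>.\<close>

lemma gram_eigenbasis:
  fixes N :: "real^'k^'m"
  obtains B l where "finite B" "card B = CARD('k)" "pairwise orthogonal B" "span B = UNIV"
    "\<And>b. b \<in> B \<Longrightarrow> norm b = 1"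
    "\<And>b. b \<in> B \<Longrightarrow> transpose N ** N *v b = l b *\<^sub>R b"
    "\<And>b. b \<in> B \<Longrightarrow> 0 \<le> l b"
    "\<And>y. (norm (N *v y))\<^sup>2 = (\<Sum>b\<in>B. l b * (y \<bullet> b)\<^sup>2)"
    "\<And>y. (norm y)\<^sup>2 = (\<Sum>b\<in>B. (y \<bullet> b)\<^sup>2)"
    "singular_values N = take (min CARD('m) CARD('k))
       (rev (sorted_list_of_multiset (image_mset (\<lambda>b. sqrt (l b)) (mset_set B))))"
proof -
  let ?G = "transpose N ** N"
  have lin: "linear ((*v) ?G)"
    by simp
  have sa: "(?G *v x) \<bullet> y = x \<bullet> (?G *v y)" for x y
    by (metis inner_gram inner_commute)
  from self_adjoint_eigenbasis[OF lin sa] obtain B l where B: "finite B" "card B = DIM(real^'k)" "pairwise orthogonal B"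
      "span B = UNIV" "\<And>b. b \<in> B \<Longrightarrow> norm b = 1" and l: "\<And>b. b \<in> B \<Longrightarrow> ?G *v b = l b *\<^sub>R b"
    by blast
  have ind: "independent B"
    using B by (intro pairwise_orthogonal_independent) force+
  have expand: "(\<Sum>b\<in>B. (y \<bullet> b) *\<^sub>R b) = y" for y
    using B by (intro orthonormal_basis_expand) auto
  have nonneg: "0 \<le> l b" if "b \<in> B" for b
  proof -
    have "l b = (?G *v b) \<bullet> b"
      using B(5)[OF that] l[OF that] by (simp add: norm_eq_1)
    then show ?thesis by (simp add: inner_gram)
  qed
  have gram: "(norm (N *v y))\<^sup>2 = (\<Sum>b\<in>B. l b * (y \<bullet> b)\<^sup>2)" for y
  proof -
    have "(norm (N *v y))\<^sup>2 = (?G *v y) \<bullet> y"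
      by (simp add: inner_gram power2_norm_eq_inner)
    also have "\<dots> = (?G *v y) \<bullet> (\<Sum>b\<in>B. (y \<bullet> b) *\<^sub>R b)"
      by (simp add: expand)
    also have "\<dots> = (\<Sum>b\<in>B. l b * (y \<bullet> b)\<^sup>2)"
      unfolding inner_sum_right by (intro sum.cong) (simp_all add: sa l power2_eq_square)
    finally show ?thesis .
  qed
  have norm2: "(norm y)\<^sup>2 = (\<Sum>b\<in>B. (y \<bullet> b)\<^sup>2)" for y
  proof -
    have "(norm y)\<^sup>2 = y \<bullet> (\<Sum>b\<in>B. (y \<bullet> b) *\<^sub>R b)"
      by (simp add: expand power2_norm_eq_inner)
    then show ?thesis
      by (simp add: inner_sum_right power2_eq_square)
  qed
  have coeff: "l b = \<mu>" if "?G *v v = \<mu> *\<^sub>R v" "b \<in> B" "v \<bullet> b \<noteq> 0" for v b \<mu>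
  proof -
    have "\<mu> * (v \<bullet> b) = l b * (v \<bullet> b)"
      using sa[of v b] that l by simp
    then show ?thesis using that by simp
  qed
  have eigenspace: "eigenspace ?G \<mu> = span {b\<in>B. l b = \<mu>}" for \<mu>
  proof
    have "v \<in> span {b\<in>B. l b = \<mu>}" if "v \<in> eigenspace ?G \<mu>" for v
    proof -
      have "(v \<bullet> b) *\<^sub>R b \<in> span {b\<in>B. l b = \<mu>}" if "b \<in> B" for b
        using coeff[of v \<mu> b] \<open>v \<in> _\<close> that
        by (cases "v \<bullet> b = 0") (auto simp: eigenspace_def span_zero intro!: span_scale intro: span_base)
      then have "(\<Sum>b\<in>B. (v \<bullet> b) *\<^sub>R b) \<in> span {b\<in>B. l b = \<mu>}"
        by (rule span_sum)
      then show ?thesis by (simp add: expand)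
    qed
    then show "eigenspace ?G \<mu> \<subseteq> span {b\<in>B. l b = \<mu>}" by blast
    have "subspace (eigenspace ?G \<mu>)"
      by (auto simp: subspace_def eigenspace_def matrix_vector_right_distrib algebra_simps
          matrix_vector_mult_scaleR)
    then show "span {b\<in>B. l b = \<mu>} \<subseteq> eigenspace ?G \<mu>"
      by (intro span_minimal) (auto simp: eigenspace_def l)
  qed
  have "eigenvalues ?G = l ` B"
  proof
    show "eigenvalues ?G \<subseteq> l ` B"
    proof
      fix \<mu> assume "\<mu> \<in> eigenvalues ?G"
      then obtain v where v: "v \<noteq> 0" "?G *v v = \<mu> *\<^sub>R v"
        by (auto simp: eigenvalues_def)
      have "\<exists>b\<in>B. v \<bullet> b \<noteq> 0"
      proof (rule ccontr)
        assume "\<not> ?thesis"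
        then have "(\<Sum>b\<in>B. (v \<bullet> b) *\<^sub>R b) = 0"
          by (intro sum.neutral) simp
        with v(1) show False by (simp add: expand)
      qed
      then show "\<mu> \<in> l ` B" using coeff[OF v(2)] by blast
    qed
    show "l ` B \<subseteq> eigenvalues ?G"
    proof
      fix \<mu> assume "\<mu> \<in> l ` B"
      then obtain b where b: "b \<in> B" "\<mu> = l b" by blast
      then have "b \<noteq> 0" using B(5)[of b] by auto
      with b l show "\<mu> \<in> eigenvalues ?G" unfolding eigenvalues_def by blast
    qed
  qed
  then have "(\<Sum>\<mu>\<in>eigenvalues ?G. replicate_mset (dim (eigenspace ?G \<mu>)) (sqrt \<mu>))
      = (\<Sum>\<mu>\<in>l ` B. \<Sum>b\<in>{b\<in>B. l b = \<mu>}. {#sqrt (l b)#})"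
  proof (intro sum.cong)
    fix \<mu>
    have "independent {b\<in>B. l b = \<mu>}"
      using ind by (rule independent_mono) auto
    then have "dim (eigenspace ?G \<mu>) = card {b\<in>B. l b = \<mu>}"
      unfolding eigenspace by (simp add: dim_eq_card_independent)
    moreover have "(\<Sum>b\<in>{b\<in>B. l b = \<mu>}. {#sqrt (l b)#}) = (\<Sum>b\<in>{b\<in>B. l b = \<mu>}. {#sqrt \<mu>#})"
      by (intro sum.cong) auto
    ultimately show "replicate_mset (dim (eigenspace ?G \<mu>)) (sqrt \<mu>)
        = (\<Sum>b\<in>{b\<in>B. l b = \<mu>}. {#sqrt (l b)#})"
      using B(1) by (simp add: sum_single_mset_const)
  qed
  also have "\<dots> = (\<Sum>b\<in>B. {#sqrt (l b)#})"
    by (rule sum.image_gen[OF B(1), symmetric])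
  also have "\<dots> = image_mset (\<lambda>b. sqrt (l b)) (mset_set B)"
    using B(1) by induction auto
  finally have "singular_values N = take (min CARD('m) CARD('k))
       (rev (sorted_list_of_multiset (image_mset (\<lambda>b. sqrt (l b)) (mset_set B))))"
    by (simp add: singular_values_def)
  with B l nonneg gram norm2 show ?thesis
    using that[of B l] by simp
qed

text \<open>Used twice in a row to read off the two smallest singular values.\<close>

lemma sorted_list_of_image_mset_remove_min:
  fixes g :: "'b \<Rightarrow> 'c::linorder"
  assumes "finite B" "b \<in> B" "\<And>c. c \<in> B \<Longrightarrow> g b \<le> g c"
  shows "sorted_list_of_multiset (image_mset g (mset_set B))
    = g b # sorted_list_of_multiset (image_mset g (mset_set (B - {b})))"
proof -
  have "mset_set B = add_mset b (mset_set (B - {b}))"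
    using assms by (simp add: mset_set.remove)
  then show ?thesis
    using assms by (simp add: insort_is_Cons)
qed

text \<open>In a Gram eigenbasis whose smallest eigenvalue belongs to \<open>v\<close> and the next
  one to \<open>w\<close>, the bounds reduce to comparing weighted sums of squares.
  \<open>CARD('k) \<le> CARD('m)\<close> ensures that the truncation in
  \<open>singular_values\<close> drops nothing.\<close>

lemma singular_value_last:
  fixes N :: "real^'k^'m"
  assumes "CARD('k) \<le> CARD('m)"
  defines "\<sigma> \<equiv> singular_value N CARD('k)"
  obtains v where "norm v = 1" "transpose N ** N *v v = \<sigma>\<^sup>2 *\<^sub>R v" "0 \<le> \<sigma>"
    "\<And>y. \<sigma> * norm y \<le> norm (N *v y)"
    "2 \<le> CARD('k) \<Longrightarrow> \<sigma> \<le> singular_value N (CARD('k) - 1)"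
    "2 \<le> CARD('k) \<Longrightarrow> \<exists>w. norm w = 1 \<and> v \<bullet> w = 0 \<and>
      transpose N ** N *v w = (singular_value N (CARD('k) - 1))\<^sup>2 *\<^sub>R w"
    "\<And>y. 2 \<le> CARD('k) \<Longrightarrow> v \<bullet> y = 0 \<Longrightarrow> singular_value N (CARD('k) - 1) * norm y \<le> norm (N *v y)"
proof -
  from gram_eigenbasis[of N] obtain B l where B: "finite B" "card B = CARD('k)" "pairwise orthogonal B" "span B = UNIV"
    "\<And>b. b \<in> B \<Longrightarrow> norm b = 1"
    and l: "\<And>b. b \<in> B \<Longrightarrow> transpose N ** N *v b = l b *\<^sub>R b"
    "\<And>b. b \<in> B \<Longrightarrow> 0 \<le> l b"
    and gram: "\<And>y. (norm (N *v y))\<^sup>2 = (\<Sum>b\<in>B. l b * (y \<bullet> b)\<^sup>2)"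
    "\<And>y. (norm y)\<^sup>2 = (\<Sum>b\<in>B. (y \<bullet> b)\<^sup>2)"
    and sv: "singular_values N = take (min CARD('m) CARD('k))
       (rev (sorted_list_of_multiset (image_mset (\<lambda>b. sqrt (l b)) (mset_set B))))"
    by blast
  define L where "L = sorted_list_of_multiset (image_mset (\<lambda>b. sqrt (l b)) (mset_set B))"
  have len: "length L = CARD('k)"
  proof -
    have "length L = size (mset L)" by simp
    also have "\<dots> = card B" unfolding L_def by simp
    finally show ?thesis using B by simp
  qed
  \<comment> \<open>\<open>L\<close> ascends, whereas singular values descend and are counted from
    1; hence the index \<open>j\<close> from the end.\<close>
  have sv_nth: "singular_value N (CARD('k) - j) = L ! j" if "j < CARD('k)" for j
    using that assms(1) len by (simp add: singular_value_def sv rev_nth flip: L_def)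
  \<comment> \<open>Only eigenvalues of basis vectors that meet \<open>y\<close> matter, so one
    statement serves both all \<open>y\<close> and those orthogonal to \<open>v\<close>.\<close>
  have bound: "sqrt \<mu> * norm y \<le> norm (N *v y)"
    if "0 \<le> \<mu>" "\<And>b. b \<in> B \<Longrightarrow> y \<bullet> b \<noteq> 0 \<Longrightarrow> \<mu> \<le> l b" for \<mu> y
  proof -
    have "\<mu> * (\<Sum>b\<in>B. (y \<bullet> b)\<^sup>2) \<le> (\<Sum>b\<in>B. l b * (y \<bullet> b)\<^sup>2)"
      unfolding sum_distrib_left
    proof (rule sum_mono)
      show "\<mu> * (y \<bullet> b)\<^sup>2 \<le> l b * (y \<bullet> b)\<^sup>2" if "b \<in> B" for b
        using \<open>\<And>b. b \<in> B \<Longrightarrow> y \<bullet> b \<noteq> 0 \<Longrightarrow> \<mu> \<le> l b\<close>[OF that]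
        by (cases "y \<bullet> b = 0") (auto intro: mult_right_mono)
    qed
    then have "(sqrt \<mu> * norm y)\<^sup>2 \<le> (norm (N *v y))\<^sup>2"
      using that(1) by (simp add: gram power_mult_distrib)
    then show ?thesis
      by (rule power2_le_imp_le) simp
  qed
  have "B \<noteq> {}"
    using B(2) by force
  then obtain v where v: "v \<in> B" "\<And>b. b \<in> B \<Longrightarrow> l v \<le> l b"
    using arg_min_if_finite[OF B(1), of l] by (metis not_le)
  define L' where "L' = sorted_list_of_multiset (image_mset (\<lambda>b. sqrt (l b)) (mset_set (B - {v})))"
  have L: "L = sqrt (l v) # L'"
    unfolding L_def L'_def using v B(1) by (intro sorted_list_of_image_mset_remove_min) auto
  have \<sigma>: "\<sigma> = sqrt (l v)"
    using sv_nth[of 0] by (simp add: \<sigma>_def L)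
  have second: "\<exists>w\<in>B. v \<noteq> w \<and> singular_value N (CARD('k) - 1) = sqrt (l w) \<and>
      (\<forall>b\<in>B. b \<noteq> v \<longrightarrow> l w \<le> l b)" if "2 \<le> CARD('k)"
  proof -
    have "card (B - {v}) \<noteq> 0"
      using that B(1,2) v(1) by (simp add: card_Diff_singleton)
    then have "B - {v} \<noteq> {}"
      by force
    then obtain w where w: "w \<in> B - {v}" "\<And>b. b \<in> B - {v} \<Longrightarrow> l w \<le> l b"
      using arg_min_if_finite[of "B - {v}" l] B(1) by (metis not_le finite_Diff)
    have "L' = sqrt (l w) # sorted_list_of_multiset (image_mset (\<lambda>b. sqrt (l b)) (mset_set (B - {v} - {w})))"
      unfolding L'_def using w B(1) by (intro sorted_list_of_image_mset_remove_min) auto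
    then have "singular_value N (CARD('k) - 1) = sqrt (l w)"
      using sv_nth[of 1] that by (simp add: L)
    with w show ?thesis by (intro bexI[of _ w]) auto
  qed
  show ?thesis
  proof
    show "norm v = 1" "transpose N ** N *v v = \<sigma>\<^sup>2 *\<^sub>R v" "0 \<le> \<sigma>"
      using B(5) v(1) l by (auto simp: \<sigma>)
    show "\<sigma> * norm y \<le> norm (N *v y)" for y
      unfolding \<sigma> using v l by (intro bound) auto
    assume k: "2 \<le> CARD('k)"
    from second[OF k] obtain w where w: "w \<in> B" "v \<noteq> w"
      "singular_value N (CARD('k) - 1) = sqrt (l w)" "\<And>b. b \<in> B \<Longrightarrow> b \<noteq> v \<Longrightarrow> l w \<le> l b"
      by blast
    show "\<sigma> \<le> singular_value N (CARD('k) - 1)"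
      using w v by (simp add: \<sigma>)
    show "\<exists>w. norm w = 1 \<and> v \<bullet> w = 0 \<and>
      transpose N ** N *v w = (singular_value N (CARD('k) - 1))\<^sup>2 *\<^sub>R w"
      using w v B l by (intro exI[of _ w]) (auto simp: pairwise_def orthogonal_def)
    show "singular_value N (CARD('k) - 1) * norm y \<le> norm (N *v y)" if "v \<bullet> y = 0" for y
      unfolding w(3) using w l that by (intro bound) (auto simp: inner_commute)
  qed
qed

section \<open>Homogeneous coordinates\<close>

text \<open>The column \<open>(u, t)\<close> in the index type of \<open>augment\<close>, so that
  \<open>augment A b\<close> sends \<open>homog y (- 1)\<close> to the residual
  \<open>A *v y - b\<close>.\<close>

definition homog :: "real^'n \<Rightarrow> real \<Rightarrow> real^('n option)" where
  "homog u t = (\<chi> j. case j of None \<Rightarrow> t | Some k \<Rightarrow> u $ k)"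

lemma homog_cases:
  obtains u t where "y = homog u t"
proof
  show "y = homog (\<chi> k. y $ Some k) (y $ None)"
    by (auto simp: homog_def vec_eq_iff split: option.split)
qed

lemma homog_eq_iff [simp]: "homog u t = homog u' t' \<longleftrightarrow> u = u' \<and> t = t'"
proof
  assume eq: "homog u t = homog u' t'"
  have "u $ k = u' $ k" for k
    using arg_cong[OF eq, of "\<lambda>y. y $ Some k"] by (simp add: homog_def)
  moreover have "t = t'"
    using arg_cong[OF eq, of "\<lambda>y. y $ None"] by (simp add: homog_def)
  ultimately show "u = u' \<and> t = t'"
    by (simp add: vec_eq_iff)
qed simp

lemma scaleR_homog: "c *\<^sub>R homog u t = homog (c *\<^sub>R u) (c * t)"
  by (auto simp: homog_def vec_eq_iff split: option.split)

lemma add_homog: "homog u t + homog u' t' = homog (u + u') (t + t')"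
  by (auto simp: homog_def vec_eq_iff split: option.split)

lemma diff_homog: "homog u t - homog u' t' = homog (u - u') (t - t')"
  by (auto simp: homog_def vec_eq_iff split: option.split)

lemma homog_eq_0_iff [simp]: "homog u t = 0 \<longleftrightarrow> u = 0 \<and> t = 0" for u :: "real^'n"
proof -
  have "(0 :: real^('n option)) = homog 0 0"
    by (auto simp: homog_def vec_eq_iff split: option.split)
  then show ?thesis by (metis homog_eq_iff)
qed

lemma sum_UNIV_option:
  fixes f :: "'n::finite option \<Rightarrow> 'a::comm_monoid_add"
  shows "(\<Sum>j\<in>UNIV. f j) = f None + (\<Sum>k\<in>UNIV. f (Some k))"
  by (simp add: UNIV_option_conv sum.reindex)

lemma inner_homog: "homog u t \<bullet> homog u' t' = u \<bullet> u' + t * t'"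
  by (simp add: homog_def inner_vec_def sum_UNIV_option)

lemma norm_homog: "norm (homog u t) = sqrt ((norm u)\<^sup>2 + t\<^sup>2)"
  by (simp add: norm_eq_sqrt_inner inner_homog power2_eq_square)

lemma augment_mult_homog: "augment A b *v homog u t = A *v u + t *\<^sub>R b"
  by (simp add: homog_def augment_def matrix_vector_mult_def vec_eq_iff sum_UNIV_option)

text \<open>Splits an eigenvector equation for the Gram matrix of \<open>[A b]\<close> into an
  equation for \<open>u\<close> and a scalar one for \<open>t\<close>.\<close>

lemma gram_augment_mult_homog:
  "transpose (augment A b) ** augment A b *v homog u t
    = homog (transpose A *v (A *v u + t *\<^sub>R b)) (b \<bullet> (A *v u + t *\<^sub>R b))"
proof -
  have "transpose (augment A b) *v y = homog (transpose A *v y) (b \<bullet> y)" for y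
    by (auto simp: homog_def augment_def matrix_vector_mult_def transpose_def vec_eq_iff
        inner_vec_def split: option.split)
  then show ?thesis
    by (simp add: augment_mult_homog flip: matrix_vector_mul_assoc)
qed

lemma norm_augment: "norm (augment A b) = norm (A, b)"
proof -
  have row: "augment A b $ i = homog (A $ i) (b $ i)" for i
    by (simp add: augment_def homog_def)
  have "(norm (augment A b))\<^sup>2 = (\<Sum>i\<in>UNIV. A $ i \<bullet> A $ i + b $ i * b $ i)"
    by (simp add: power2_norm_eq_inner inner_vec_def[of "augment A b"] row inner_homog)
  also have "\<dots> = (norm A)\<^sup>2 + (norm b)\<^sup>2"
    by (simp add: power2_norm_eq_inner inner_vec_def[of A] inner_vec_def[of b] sum.distrib)
  finally show ?thesis
    by (metis norm_Pair norm_ge_zero real_sqrt_unique)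
qed

lemma augment_diff: "augment (A - A') (b - b') = augment A b - augment A' b'"
  by (auto simp: augment_def vec_eq_iff split: option.split)

lemma norm_matrix_vector_mult_le: "norm (N *v y) \<le> norm N * norm y"
  for N :: "real^'n^'m"
proof -
  have "norm (N *v y) = L2_set (\<lambda>i. norm (N $ i \<bullet> y)) UNIV"
    by (simp add: norm_vec_def matrix_vector_mult_def inner_vec_def)
  also have "\<dots> \<le> L2_set (\<lambda>i. norm (N $ i) * norm y) UNIV"
    by (intro L2_set_mono) (auto simp: Cauchy_Schwarz_ineq2)
  also have "\<dots> = norm N * norm y"
    by (simp add: norm_vec_def L2_set_left_distrib)
  finally show ?thesis .
qed

text \<open>The rank-one matrix \<open>a v\<^sup>T\<close>. In the Frobenius inner product it
  represents the functional \<open>H \<mapsto> a \<bullet> (H *v v)\<close>, which makes it the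
  building block of gradients and adjoints.\<close>

definition outer_prod :: "real^'m \<Rightarrow> real^'n \<Rightarrow> real^'n^'m" where
  "outer_prod a v = (\<chi> i j. a $ i * v $ j)"

lemma inner_outer_prod: "H \<bullet> outer_prod a v = a \<bullet> (H *v v)"
  by (simp add: outer_prod_def inner_vec_def matrix_vector_mult_def sum_distrib_left mult_ac)

lemma outer_prod_mult: "outer_prod a v *v y = (v \<bullet> y) *\<^sub>R a"
  by (simp add: outer_prod_def inner_vec_def matrix_vector_mult_def vec_eq_iff sum_distrib_left mult_ac)

lemma norm_outer_prod: "norm (outer_prod a v) = norm a * norm v"
  by (simp add: norm_eq_sqrt_inner inner_outer_prod outer_prod_mult real_sqrt_mult)

declare transpose_matrix_vector [simp del]

lemma transpose_mult_inner: "(transpose A *v y) \<bullet> z = y \<bullet> (A *v z)"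
  for A :: "real^'n^'m"
  by (metis dot_lmul_matrix transpose_matrix_vector)

section \<open>The total least squares solution\<close>

text \<open>The index type \<open>'n option\<close> has \<open>CARD('n) + 1\<close> elements, so
  \<open>\<sigma>\<close> is the last singular value and \<open>singular_value_last\<close> applies,
  read in coordinates \<open>(u, t)\<close>.\<close>

lemma least_singular_augment:
  fixes A :: "real^'n^'m" and b :: "real^'m"
  assumes card: "CARD('n) < CARD('m)"
  defines "\<sigma> \<equiv> singular_value (augment A b) (CARD('n) + 1)"
  shows least_singular_augment_nonneg: "0 \<le> \<sigma>"
    and least_singular_augment_le: "\<sigma> * norm (homog u t) \<le> norm (A *v u + t *\<^sub>R b)"
    and least_singular_augment_eigenvector:
      "\<exists>u t. homog u t \<noteq> 0 \<and> transpose A *v (A *v u + t *\<^sub>R b) = \<sigma>\<^sup>2 *\<^sub>R u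
         \<and> b \<bullet> (A *v u + t *\<^sub>R b) = \<sigma>\<^sup>2 * t"
proof -
  have le: "CARD('n option) \<le> CARD('m)"
    using card by simp
  have suc: "CARD('n option) = CARD('n) + 1"
    by simp
  obtain v where
    v: "norm v = 1" "transpose (augment A b) ** augment A b *v v = \<sigma>\<^sup>2 *\<^sub>R v" "0 \<le> \<sigma>"
    "\<And>y. \<sigma> * norm y \<le> norm (augment A b *v y)"
    by (rule singular_value_last[OF le, of "augment A b", unfolded suc, folded \<sigma>_def])
      (rule that; blast)
  show "0 \<le> \<sigma>" by fact
  show "\<sigma> * norm (homog u t) \<le> norm (A *v u + t *\<^sub>R b)"
    using v(4)[of "homog u t"] by (simp add: augment_mult_homog)
  obtain u t where "v = homog u t"
    by (rule homog_cases)
  with v show "\<exists>u t. homog u t \<noteq> 0 \<and> transpose A *v (A *v u + t *\<^sub>R b) = \<sigma>\<^sup>2 *\<^sub>R u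
         \<and> b \<bullet> (A *v u + t *\<^sub>R b) = \<sigma>\<^sup>2 * t"
    by (intro exI[of _ u] exI[of _ t])
      (auto simp: gram_augment_mult_homog scaleR_homog norm_homog)
qed

lemma matrix_inv_mult:
  fixes M :: "real^'n^'n"
  assumes "\<And>u. M *v u = 0 \<Longrightarrow> u = 0"
  shows "M *v (matrix_inv M *v y) = y" and "matrix_inv M *v (M *v y) = y"
proof -
  have "invertible M"
    using assms by (simp add: invertible_left_inverse matrix_left_invertible_ker)
  then have "M ** matrix_inv M = mat 1 \<and> matrix_inv M ** M = mat 1"
    unfolding invertible_def matrix_inv_def by (rule someI_ex)
  then show "M *v (matrix_inv M *v y) = y" "matrix_inv M *v (M *v y) = y"
    by (simp_all add: matrix_vector_mul_assoc)
qed

lemma shifted_gram_mult: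
  "(transpose A ** A - c *\<^sub>R mat 1) *v u = transpose A *v (A *v u) - c *\<^sub>R u"
  for A :: "real^'n^'m"
  by (simp add: matrix_vector_mult_diff_rdistrib matrix_vector_mul_assoc scaleR_matrix_vector_assoc[symmetric])

lemma shifted_gram_inj:
  fixes A :: "real^'n^'m"
  assumes gap: "\<And>u. u \<noteq> 0 \<Longrightarrow> c * (norm u)\<^sup>2 < (norm (A *v u))\<^sup>2"
    and "(transpose A ** A - c *\<^sub>R mat 1) *v u = 0"
  shows "u = 0"
proof (rule ccontr)
  assume "u \<noteq> 0"
  have "((transpose A ** A - c *\<^sub>R mat 1) *v u) \<bullet> u = (norm (A *v u))\<^sup>2 - c * (norm u)\<^sup>2"
    by (simp add: shifted_gram_mult inner_diff_left transpose_mult_inner power2_norm_eq_inner)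
  with gap[OF \<open>u \<noteq> 0\<close>] assms(2) show False by simp
qed

text \<open>An eigenvector \<open>(u, t)\<close> for \<open>\<sigma>\<^sup>2\<close> has
  \<open>t \<noteq> 0\<close>, as otherwise \<open>u\<close> would violate the gap. Scaled to last
  component \<open>- 1\<close>, its upper part solves the equation that defines
  \<open>tls_map\<close>, which has only one solution.\<close>

lemma tls_map_normal_equations:
  fixes A :: "real^'n^'m" and b :: "real^'m"
  assumes card: "CARD('n) < CARD('m)"
  defines "\<sigma> \<equiv> singular_value (augment A b) (CARD('n) + 1)"
  assumes gap: "\<And>u. u \<noteq> 0 \<Longrightarrow> \<sigma>\<^sup>2 * (norm u)\<^sup>2 < (norm (A *v u))\<^sup>2"
  defines "x \<equiv> tls_map (A, b)"
  shows "transpose A *v (A *v x - b) = \<sigma>\<^sup>2 *\<^sub>R x"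
    and "b \<bullet> (A *v x - b) = - \<sigma>\<^sup>2"
    and "(norm (A *v x - b))\<^sup>2 = \<sigma>\<^sup>2 * (1 + (norm x)\<^sup>2)"
    and "\<And>y. transpose A *v (A *v y - b) = \<sigma>\<^sup>2 *\<^sub>R y \<Longrightarrow> y = x"
proof -
  let ?M = "transpose A ** A - \<sigma>\<^sup>2 *\<^sub>R mat 1"
  have inj: "u = 0" if "?M *v u = 0" for u
    using shifted_gram_inj[of "\<sigma>\<^sup>2" A u] gap that by simp
  have x: "x = matrix_inv ?M *v (transpose A *v b)"
    by (simp add: x_def tls_map_def \<sigma>_def)
  show unique: "y = x" if "transpose A *v (A *v y - b) = \<sigma>\<^sup>2 *\<^sub>R y" for y
  proof -
    have "?M *v y = transpose A *v b"
      using that unfolding shifted_gram_mult by (simp add: algebra_simps)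
    then show ?thesis
      using matrix_inv_mult(2)[of ?M y] inj by (simp add: x)
  qed
  obtain u t where ut: "homog u t \<noteq> 0" "transpose A *v (A *v u + t *\<^sub>R b) = \<sigma>\<^sup>2 *\<^sub>R u"
      "b \<bullet> (A *v u + t *\<^sub>R b) = \<sigma>\<^sup>2 * t"
    using least_singular_augment_eigenvector[OF card, of A b] by (auto simp: \<sigma>_def)
  have t: "t \<noteq> 0"
  proof
    assume "t = 0"
    with ut have u: "u \<noteq> 0" "transpose A *v (A *v u) = \<sigma>\<^sup>2 *\<^sub>R u" by auto
    then have "(norm (A *v u))\<^sup>2 = \<sigma>\<^sup>2 * (norm u)\<^sup>2"
      using transpose_mult_inner[of A "A *v u" u] by (simp add: power2_norm_eq_inner)
    with gap[OF u(1)] show False by simp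
  qed
  define w where "w = (- 1 / t) *\<^sub>R u"
  have w: "A *v w - b = (- 1 / t) *\<^sub>R (A *v u + t *\<^sub>R b)"
    unfolding w_def matrix_vector_mult_scaleR using t by (simp add: scaleR_right_distrib)
  have eq: "transpose A *v (A *v w - b) = \<sigma>\<^sup>2 *\<^sub>R w"
    unfolding w matrix_vector_mult_scaleR ut(2) by (simp add: w_def)
  then have "w = x"
    by (rule unique)
  then show 1: "transpose A *v (A *v x - b) = \<sigma>\<^sup>2 *\<^sub>R x"
    using eq by simp
  show 2: "b \<bullet> (A *v x - b) = - \<sigma>\<^sup>2"
    using t unfolding \<open>w = x\<close>[symmetric] w inner_scaleR_right ut(3) by simp
  have "(norm (A *v x - b))\<^sup>2 = (A *v x - b) \<bullet> (A *v x) - b \<bullet> (A *v x - b)"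
    by (simp add: power2_norm_eq_inner inner_diff_left inner_diff_right inner_commute)
  also have "(A *v x - b) \<bullet> (A *v x) = \<sigma>\<^sup>2 * (norm x)\<^sup>2"
    using 1 by (simp flip: transpose_mult_inner add: power2_norm_eq_inner)
  finally show "(norm (A *v x - b))\<^sup>2 = \<sigma>\<^sup>2 * (1 + (norm x)\<^sup>2)"
    using 2 by (simp add: algebra_simps)
qed

text \<open>A rank-one correction shows that the optimal value is at most \<open>\<sigma>\<close>.
  Since \<open>[E r]\<close> maps \<open>(x, 1)\<close> to \<open>b - A x\<close>, the vector
  \<open>(x, - 1)\<close> then attains the least Rayleigh quotient \<open>\<sigma>\<^sup>2\<close>,
  so it is an eigenvector and \<open>x\<close> satisfies the normal equations.\<close>

lemma tls_solution_eq_tls_map: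
  fixes A :: "real^'n^'m" and b :: "real^'m"
  assumes card: "CARD('n) < CARD('m)"
  defines "\<sigma> \<equiv> singular_value (augment A b) (CARD('n) + 1)"
  assumes gap: "\<And>u. u \<noteq> 0 \<Longrightarrow> \<sigma>\<^sup>2 * (norm u)\<^sup>2 < (norm (A *v u))\<^sup>2"
    and sol: "tls_solution A b x"
  shows "x = tls_map (A, b)"
proof -
  define x0 where "x0 = tls_map (A, b)"
  note x0 = tls_map_normal_equations[OF card gap[unfolded \<sigma>_def], folded \<sigma>_def x0_def]
  note \<sigma>0 = least_singular_augment_nonneg[OF card, of A b, folded \<sigma>_def]
  note \<sigma>_le = least_singular_augment_le[OF card, of A b, folded \<sigma>_def]
  obtain E r where min: "tls_minimizer A b E r" and x: "(A + E) *v x = b - r"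
    using sol by (auto simp: tls_solution_def)
  define c where "c = 1 + (norm x0)\<^sup>2"
  have c: "c > 0" by (simp add: c_def add_pos_nonneg)
  \<comment> \<open>The correction \<open>[E r] = a (x0, 1)\<^sup>T\<close> makes \<open>x0\<close>
    fit exactly; by the normal equations its norm is \<open>\<sigma>\<close>.\<close>
  define a where "a = (- 1 / c) *\<^sub>R (A *v x0 - b)"
  have "(A + outer_prod a x0) *v x0 = b - a"
  proof -
    have "(A + outer_prod a x0) *v x0 = A *v x0 + (x0 \<bullet> x0) *\<^sub>R a"
      by (simp add: matrix_vector_mult_add_rdistrib outer_prod_mult)
    also have "(x0 \<bullet> x0) *\<^sub>R a = c *\<^sub>R a - a"
      by (simp add: c_def power2_norm_eq_inner algebra_simps)
    also have "c *\<^sub>R a = b - A *v x0"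
      using c by (simp add: a_def)
    finally show ?thesis by simp
  qed
  then have "tls_feasible A b (outer_prod a x0) a"
    unfolding tls_feasible_def by (metis rangeI)
  then have le: "norm (augment E r) \<le> norm (augment (outer_prod a x0) a)"
    using min by (simp add: tls_minimizer_def)
  have "(norm (augment (outer_prod a x0) a))\<^sup>2 = (norm a)\<^sup>2 * c"
    by (simp add: norm_augment norm_Pair norm_outer_prod c_def power_mult_distrib algebra_simps)
  also have "(norm a)\<^sup>2 * c = \<sigma>\<^sup>2"
  proof -
    have "(norm a)\<^sup>2 = (norm (A *v x0 - b))\<^sup>2 / c\<^sup>2"
      by (simp add: a_def power_divide)
    also have "\<dots> = \<sigma>\<^sup>2 * c / c\<^sup>2"
      by (simp add: x0(3) c_def)
    finally show ?thesis
      using c by (simp add: power2_eq_square)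
  qed
  finally have "norm (augment (outer_prod a x0) a) = \<sigma>"
    using \<sigma>0 by (simp add: power2_eq_iff_nonneg)
  with le have E_le: "norm (augment E r) \<le> \<sigma>" by simp
  have "A *v x + (- 1) *\<^sub>R b = - (augment E r *v homog x 1)"
    using x by (simp add: augment_mult_homog matrix_vector_mult_add_rdistrib algebra_simps)
  then have "norm (A *v x + (- 1) *\<^sub>R b) \<le> norm (augment E r) * norm (homog x 1)"
    by (metis norm_minus_cancel norm_matrix_vector_mult_le)
  also have "\<dots> \<le> \<sigma> * norm (homog x (- 1))"
    using E_le by (simp add: norm_homog mult_right_mono)
  finally have attained: "norm (augment A b *v homog x (- 1)) = \<sigma> * norm (homog x (- 1))"
    using \<sigma>_le[of x "- 1"] by (simp add: augment_mult_homog)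
  let ?G = "transpose (augment A b) ** augment A b"
  have "?G *v homog x (- 1) = \<sigma>\<^sup>2 *\<^sub>R homog x (- 1)"
  proof (rule rayleigh_minimizer_eigenvector[where S = UNIV])
    show "(?G *v y) \<bullet> z = y \<bullet> (?G *v z)" for y z
      by (metis inner_gram inner_commute)
    show "\<sigma>\<^sup>2 * (y \<bullet> y) \<le> (?G *v y) \<bullet> y" for y
    proof -
      obtain u t where y: "y = homog u t" by (rule homog_cases)
      have "(\<sigma> * norm y)\<^sup>2 \<le> (norm (augment A b *v y))\<^sup>2"
        using \<sigma>_le[of u t] \<sigma>0 by (intro power_mono) (simp_all add: y augment_mult_homog)
      then show ?thesis
        by (simp add: inner_gram power_mult_distrib power2_norm_eq_inner)
    qed
    show "(?G *v homog x (- 1)) \<bullet> homog x (- 1) = \<sigma>\<^sup>2 * (homog x (- 1) \<bullet> homog x (- 1))"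
      using arg_cong[OF attained, of power2]
      by (simp add: inner_gram power_mult_distrib power2_norm_eq_inner)
  qed simp_all
  then have "transpose A *v (A *v x - b) = \<sigma>\<^sup>2 *\<^sub>R x"
    by (simp add: gram_augment_mult_homog scaleR_homog)
  then show ?thesis
    using x0(4) by (simp add: x0_def)
qed

section \<open>Differentiability of the solution map\<close>

lemma norm_transpose: "norm (transpose A) = norm A"
  for A :: "real^'n^'m"
proof -
  have "transpose A \<bullet> transpose A = A \<bullet> A"
    unfolding inner_vec_def transpose_def by (simp add: inner_vec_def) (rule sum.swap)
  then show ?thesis
    by (simp add: norm_eq_sqrt_inner)
qed

lemma bounded_bilinear_matrix_vector_mult: "bounded_bilinear (\<lambda>(A :: real^'n^'m) y. A *v y)"
proof
  show "\<exists>K. \<forall>(A :: real^'n^'m) y. norm (A *v y) \<le> norm A * norm y * K"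
    using norm_matrix_vector_mult_le by (intro exI[of _ 1]) auto
qed (simp_all add: matrix_vector_mult_add_rdistrib matrix_vector_right_distrib
    scaleR_matrix_vector_assoc matrix_vector_mult_scaleR)

lemma bounded_linear_transpose: "bounded_linear (transpose :: real^'n^'m \<Rightarrow> real^'m^'n)"
proof
  show "\<exists>K. \<forall>A :: real^'n^'m. norm (transpose A) \<le> norm A * K"
    by (intro exI[of _ 1]) (simp add: norm_transpose)
qed (simp_all add: transpose_def vec_eq_iff)

lemma has_derivativeI_eventually:
  assumes "bounded_linear f'"
    and "\<forall>\<^sub>F y in at x. norm (f y - f x - f' (y - x)) \<le> h y * norm (y - x)"
    and "(h \<longlongrightarrow> 0) (at x)"
  shows "(f has_derivative f') (at x)"
  unfolding has_derivative_iff_norm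
proof
  show "((\<lambda>y. norm (f y - f x - f' (y - x)) / norm (y - x)) \<longlongrightarrow> 0) (at x)"
  proof (rule Lim_null_comparison[OF _ assms(3)])
    show "\<forall>\<^sub>F y in at x. norm (norm (f y - f x - f' (y - x)) / norm (y - x)) \<le> h y"
      using assms(2) eventually_neq_at_within[of x x UNIV]
      by eventually_elim (simp add: field_simps)
  qed
qed (fact assms(1))

text \<open>Cauchy-Schwarz against \<open>u\<close> carries a lower bound of the quadratic form over
  to the image; holding for all \<open>u\<close>, it bounds the inverse of the shifted Gram matrix
  by \<open>1 / k\<close>.\<close>

lemma shifted_gram_coercive:
  fixes B :: "real^'n^'m"
  assumes "0 < k" "k * (norm u)\<^sup>2 \<le> (norm (B *v u))\<^sup>2 - l * (norm u)\<^sup>2"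
  shows "k * norm u \<le> norm (transpose B *v (B *v u) - l *\<^sub>R u)"
proof (cases "u = 0")
  case False
  have "k * norm u * norm u \<le> (transpose B *v (B *v u) - l *\<^sub>R u) \<bullet> u"
    using assms(2)
    by (simp add: inner_diff_left transpose_mult_inner flip: power2_norm_eq_inner)
      (simp add: power2_eq_square)
  also have "\<dots> \<le> norm (transpose B *v (B *v u) - l *\<^sub>R u) * norm u"
    by (rule norm_cauchy_schwarz)
  finally show ?thesis using False by simp
qed simp

section \<open>Perturbation of the least singular value\<close>

definition least_sv :: "(real^'n^'m) \<times> (real^'m) \<Rightarrow> real" where
  "least_sv p = singular_value (augment (fst p) (snd p)) (CARD('n) + 1)"

text \<open>Inserting the minimizing vector for \<open>q\<close> into the quotient for
  \<open>p\<close> costs at most the Frobenius norm of the difference; exchanging \<open>p\<close>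
  and \<open>q\<close> gives the other side.\<close>

lemma least_sv_lipschitz:
  fixes p q :: "(real^'n^'m) \<times> (real^'m)"
  assumes card: "CARD('n) < CARD('m)"
  shows "\<bar>least_sv p - least_sv q\<bar> \<le> norm (p - q)"
proof -
  have le: "least_sv p \<le> least_sv q + norm (p - q)" for p q :: "(real^'n^'m) \<times> (real^'m)"
  proof -
    obtain A b where p: "p = (A, b)" by fastforce
    obtain A' b' where q: "q = (A', b')" by fastforce
    obtain u t where ut: "homog u t \<noteq> 0"
        "transpose A' *v (A' *v u + t *\<^sub>R b') = (least_sv q)\<^sup>2 *\<^sub>R u"
        "b' \<bullet> (A' *v u + t *\<^sub>R b') = (least_sv q)\<^sup>2 * t"
      using least_singular_augment_eigenvector[OF card, of A' b'] by (auto simp: least_sv_def q)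
    let ?y = "homog u t" and ?w = "A' *v u + t *\<^sub>R b'"
    have "(norm ?w)\<^sup>2 = (transpose A' *v ?w) \<bullet> u + t * (b' \<bullet> ?w)"
      using inner_add_right[of ?w "A' *v u" "t *\<^sub>R b'"]
      by (simp only: power2_norm_eq_inner transpose_mult_inner inner_scaleR_right inner_commute[of ?w b'])
    also have "\<dots> = (least_sv q * norm ?y)\<^sup>2"
      unfolding ut by (simp add: norm_homog power_mult_distrib dot_square_norm algebra_simps) (simp add: power2_eq_square)
    finally have w: "norm ?w = least_sv q * norm ?y"
      using least_singular_augment_nonneg[OF card, of A' b'] by (simp add: power2_eq_iff_nonneg q least_sv_def)
    have "least_sv p * norm ?y \<le> norm (augment A b *v ?y)"
      using least_singular_augment_le[OF card, of A b] by (simp add: p least_sv_def augment_mult_homog)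
    also have "augment A b *v ?y = ?w + augment (A - A') (b - b') *v ?y"
      by (simp add: augment_diff matrix_vector_mult_diff_rdistrib augment_mult_homog)
    also have "norm \<dots> \<le> norm ?w + norm (p - q) * norm ?y"
      using norm_matrix_vector_mult_le[of "augment (A - A') (b - b')" ?y]
      by (intro norm_triangle_le) (simp add: norm_augment p q)
    finally have "least_sv p * norm ?y \<le> (least_sv q + norm (p - q)) * norm ?y"
      by (simp add: w algebra_simps)
    then show ?thesis using ut(1) by simp
  qed
  from le[of p q] le[of q p] show ?thesis
    by (simp add: norm_minus_commute abs_le_iff)
qed

lemma norm_perturbed_residual_le:
  fixes D :: "(real^'n^'m) \<times> (real^'m)"
  shows "(norm (fst D *v y - snd D))\<^sup>2 \<le> (norm D)\<^sup>2 * (1 + (norm y)\<^sup>2)"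
proof -
  have "norm (augment (fst D) (snd D) *v homog y (- 1)) \<le> norm D * norm (homog y (- 1))"
    using norm_matrix_vector_mult_le[of "augment (fst D) (snd D)"] by (simp add: norm_augment)
  then have "(norm (augment (fst D) (snd D) *v homog y (- 1)))\<^sup>2 \<le> (norm D * norm (homog y (- 1)))\<^sup>2"
    by (intro power_mono) auto
  then show ?thesis
    by (simp add: augment_mult_homog norm_homog power_mult_distrib add.commute)
qed

text \<open>\<open>c\<close> quantifies the gap between
  \<open>\<sigma>\<^sub>n\<^sub>+\<^sub>1\<^sup>2\<close> and the spectrum of
  \<open>A\<^sup>T A\<close>; it controls the inverse of \<open>M\<close> and, halved, those of the
  nearby matrices.\<close>

locale tls_gap =
  fixes A :: "real^'n^'m" and b :: "real^'m" and c :: real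
  assumes card: "CARD('n) < CARD('m)"
    and c_pos: "0 < c"
    and gap: "\<And>u. ((least_sv (A, b))\<^sup>2 + c) * (norm u)\<^sup>2 \<le> (norm (A *v u))\<^sup>2"
begin

definition x where "x = tls_map (A, b)"
definition r where "r = A *v x - b"
definition lam where "lam = (least_sv (A, b))\<^sup>2"
definition M where "M = transpose A ** A - lam *\<^sub>R mat 1"

lemma lam_nonneg: "0 \<le> lam"
  by (simp add: lam_def)

lemma gap': "u \<noteq> 0 \<Longrightarrow> lam * (norm u)\<^sup>2 < (norm (A *v u))\<^sup>2"
  using gap[of u] c_pos unfolding lam_def
  by (smt (verit) distrib_right mult_pos_pos zero_less_norm_iff zero_less_power)

lemma normal_equations:
  "transpose A *v r = lam *\<^sub>R x" "b \<bullet> r = - lam" "(norm r)\<^sup>2 = lam * (1 + (norm x)\<^sup>2)"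
  using tls_map_normal_equations(1-3)[OF card, of A b] gap'
  by (simp_all add: r_def x_def lam_def least_sv_def)

lemma M_mult: "M *v u = transpose A *v (A *v u) - lam *\<^sub>R u"
  by (simp add: M_def shifted_gram_mult)

lemma M_self_adjoint: "(M *v u) \<bullet> v = u \<bullet> (M *v v)"
  by (simp add: M_mult inner_diff_left inner_diff_right transpose_mult_inner inner_commute)
     (metis inner_commute transpose_mult_inner)

lemma M_inv: "M *v (matrix_inv M *v y) = y" "matrix_inv M *v (M *v y) = y"
  using matrix_inv_mult[of M] shifted_gram_inj[of lam A] gap' by (simp_all add: M_def)

lemma M_coercive: "c * norm u \<le> norm (M *v u)"
  unfolding M_mult using gap[of u]
  by (intro shifted_gram_coercive c_pos) (simp add: lam_def algebra_simps)

lemma tendsto_least_sv: "((\<lambda>p. (least_sv p)\<^sup>2) \<longlongrightarrow> lam) (at (A, b))"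
proof -
  have "((\<lambda>p. least_sv p - least_sv (A, b)) \<longlongrightarrow> 0) (at (A, b))"
  proof (rule Lim_null_comparison)
    show "\<forall>\<^sub>F p in at (A, b). norm (least_sv p - least_sv (A, b)) \<le> norm (p - (A, b))"
      using least_sv_lipschitz[OF card] by (intro always_eventually) auto
    show "((\<lambda>p. norm (p - (A, b))) \<longlongrightarrow> 0) (at (A, b))"
      by (auto intro!: tendsto_eq_intros)
  qed
  then have "(least_sv \<longlongrightarrow> least_sv (A, b)) (at (A, b))"
    by (simp add: LIM_zero_iff)
  then show ?thesis
    unfolding lam_def by (intro tendsto_intros)
qed

text \<open>With \<open>m = sqrt (lam + c)\<close>, any \<open>p\<close> satisfies
  \<open>(m - norm (p - (A, b))) * norm u \<le> norm (fst p *v u)\<close>, and the square of the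
  factor minus \<open>(least_sv p)\<^sup>2\<close> tends to \<open>c\<close>, hence eventually
  exceeds \<open>c / 2\<close>.\<close>

lemma eventually_gap:
  "\<forall>\<^sub>F p in at (A, b). \<forall>u. c / 2 * (norm u)\<^sup>2 \<le> (norm (fst p *v u))\<^sup>2 - (least_sv p)\<^sup>2 * (norm u)\<^sup>2"
proof -
  define m where "m = sqrt (lam + c)"
  have m: "m > 0" "m\<^sup>2 = lam + c"
    using lam_nonneg c_pos by (simp_all add: m_def)
  have Au: "m * norm u \<le> norm (A *v u)" for u
  proof (rule power2_le_imp_le)
    show "(m * norm u)\<^sup>2 \<le> (norm (A *v u))\<^sup>2"
      using gap[of u] by (simp add: power_mult_distrib m lam_def)
  qed simp
  have "((\<lambda>p. norm (p - (A, b))) \<longlongrightarrow> 0) (at (A, b))"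
    by (auto intro!: tendsto_eq_intros)
  moreover from this have "((\<lambda>p. (m - norm (p - (A, b)))\<^sup>2 - (least_sv p)\<^sup>2) \<longlongrightarrow> (m - 0)\<^sup>2 - lam) (at (A, b))"
    by (intro tendsto_intros tendsto_least_sv)
  then have "((\<lambda>p. (m - norm (p - (A, b)))\<^sup>2 - (least_sv p)\<^sup>2) \<longlongrightarrow> c) (at (A, b))"
    by (simp add: m)
  \<comment> \<open>The first condition keeps the factor positive, so that the estimate can be
    squared.\<close>
  ultimately have "\<forall>\<^sub>F p in at (A, b). norm (p - (A, b)) < m"
    "\<forall>\<^sub>F p in at (A, b). c / 2 < (m - norm (p - (A, b)))\<^sup>2 - (least_sv p)\<^sup>2"
    using m(1) c_pos by (auto dest!: order_tendstoD(1)[of _ c _ "c / 2"] order_tendstoD(2)[of _ 0 _ m])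
  then show ?thesis
  proof eventually_elim
    case (elim p)
    show ?case
    proof
      fix u
      have "norm (A *v u) \<le> norm (fst p *v u) + norm ((fst p - A) *v u)"
        by (metis matrix_vector_mult_diff_rdistrib norm_minus_commute norm_triangle_sub)
      also have "norm ((fst p - A) *v u) \<le> norm (fst p - A) * norm u"
        by (rule norm_matrix_vector_mult_le)
      also have "\<dots> \<le> norm (p - (A, b)) * norm u"
        by (intro mult_right_mono norm_ge_zero) (metis fst_conv fst_diff norm_fst_le prod.collapse)
      finally have "(m - norm (p - (A, b))) * norm u \<le> norm (fst p *v u)"
        using Au[of u] by (simp add: algebra_simps)
      then have "((m - norm (p - (A, b))) * norm u)\<^sup>2 \<le> (norm (fst p *v u))\<^sup>2"
        using elim(1) by (intro power_mono) auto
      moreover have "c / 2 * (norm u)\<^sup>2 \<le> ((m - norm (p - (A, b)))\<^sup>2 - (least_sv p)\<^sup>2) * (norm u)\<^sup>2"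
        using elim(2) by (intro mult_right_mono) auto
      ultimately show "c / 2 * (norm u)\<^sup>2 \<le> (norm (fst p *v u))\<^sup>2 - (least_sv p)\<^sup>2 * (norm u)\<^sup>2"
        unfolding power_mult_distrib left_diff_distrib[of "(m - norm (p - (A, b)))\<^sup>2"] by linarith
    qed
  qed
qed

section \<open>Perturbed normal equations and continuity of the solution map\<close>

text \<open>The residual of the unperturbed solution in the perturbed normal equations.\<close>

definition \<rho> where
  "\<rho> p = (least_sv p)\<^sup>2 *\<^sub>R x - transpose (fst p) *v (fst p *v x - snd p)"

text \<open>The gap persists, so the normal equations hold at \<open>p\<close>; comparing them with
  the same expressions at \<open>x\<close> leaves a linear system for the displacement, and
  coercivity with \<open>c / 2\<close> bounds its solution.\<close>

lemma eventually_perturbed_solution: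
  "\<forall>\<^sub>F p in at (A, b).
     (norm (fst p *v tls_map p - snd p))\<^sup>2 = (least_sv p)\<^sup>2 * (1 + (norm (tls_map p))\<^sup>2)
     \<and> transpose (fst p) *v (fst p *v (tls_map p - x)) - (least_sv p)\<^sup>2 *\<^sub>R (tls_map p - x) = \<rho> p
     \<and> c / 2 * norm (tls_map p - x) \<le> norm (\<rho> p)"
  using eventually_gap
proof eventually_elim
  case (elim p)
  obtain A' b' where p: "p = (A', b')" by fastforce
  have "(least_sv p)\<^sup>2 * (norm u)\<^sup>2 < (norm (A' *v u))\<^sup>2" if "u \<noteq> 0" for u
  proof -
    have "0 < c / 2 * (norm u)\<^sup>2" using c_pos that by simp
    also have "\<dots> \<le> (norm (A' *v u))\<^sup>2 - (least_sv p)\<^sup>2 * (norm u)\<^sup>2"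
      using elim by (simp add: p)
    finally show ?thesis by simp
  qed
  then have eq: "transpose A' *v (A' *v tls_map p - b') = (least_sv p)\<^sup>2 *\<^sub>R tls_map p"
    "(norm (A' *v tls_map p - b'))\<^sup>2 = (least_sv p)\<^sup>2 * (1 + (norm (tls_map p))\<^sup>2)"
    using tls_map_normal_equations(1,3)[OF card, of A' b'] by (simp_all add: p least_sv_def)
  have \<rho>: "transpose A' *v (A' *v (tls_map p - x)) - (least_sv p)\<^sup>2 *\<^sub>R (tls_map p - x) = \<rho> p"
    using eq(1) by (simp add: \<rho>_def p algebra_simps)
  moreover have "c / 2 * norm (tls_map p - x) \<le> norm (\<rho> p)"
    unfolding \<rho>[symmetric] using elim c_pos by (intro shifted_gram_coercive) (simp_all add: p)
  ultimately show ?case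
    using eq by (simp add: p)
qed

lemma \<rho>_zero: "\<rho> (A, b) = 0"
  using normal_equations(1) by (simp add: \<rho>_def r_def lam_def)

text \<open>\<open>\<rho>\<close> tends to 0 and dominates the displacement up to the factor
  \<open>2 / c\<close>.\<close>

lemma tendsto_tls_map: "(tls_map \<longlongrightarrow> x) (at (A, b))"
proof -
  have "(\<rho> \<longlongrightarrow> lam *\<^sub>R x - transpose A *v (A *v x - b)) (at (A, b))"
    unfolding \<rho>_def
    by (intro tendsto_intros tendsto_least_sv bounded_bilinear.tendsto[OF bounded_bilinear_matrix_vector_mult]
        bounded_linear.tendsto[OF bounded_linear_transpose] tendsto_eq_rhs[OF tendsto_fst[OF tendsto_ident_at]]
        tendsto_eq_rhs[OF tendsto_snd[OF tendsto_ident_at]]) auto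
  then have "(\<rho> \<longlongrightarrow> 0) (at (A, b))"
    using normal_equations(1) by (simp add: r_def)
  then have "((\<lambda>p. norm (\<rho> p) * (2 / c)) \<longlongrightarrow> 0 * (2 / c)) (at (A, b))"
    by (intro tendsto_mult tendsto_const tendsto_norm_zero)
  then have "((\<lambda>p. norm (\<rho> p) * (2 / c)) \<longlongrightarrow> 0) (at (A, b))"
    by simp
  moreover have "\<forall>\<^sub>F p in at (A, b). norm (tls_map p - x) \<le> norm (\<rho> p) * (2 / c)"
    using eventually_perturbed_solution by eventually_elim (use c_pos in \<open>simp add: field_simps\<close>)
  ultimately have "((\<lambda>p. tls_map p - x) \<longlongrightarrow> 0) (at (A, b))"
    by (rule Lim_null_comparison[rotated])
  then show ?thesis
    by (simp add: LIM_zero_iff)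
qed

section \<open>Derivative of the least eigenvalue\<close>

text \<open>The gradient at \<open>(A, b)\<close> of the quotient \<open>\<bar>A y - b\<bar>\<^sup>2 / (1 + \<bar>y\<bar>\<^sup>2)\<close> as a function of the data.\<close>

definition grad where
  "grad y = (2 / (1 + (norm y)\<^sup>2)) *\<^sub>R (outer_prod (A *v y - b) y, - (A *v y - b))"

lemma inner_grad: "D \<bullet> grad y = 2 * ((A *v y - b) \<bullet> (fst D *v y - snd D)) / (1 + (norm y)\<^sup>2)"
proof -
  have inner: "D \<bullet> (k *\<^sub>R (outer_prod q y, - q)) = k * (q \<bullet> (fst D *v y - snd D))" for k q
    by (simp add: inner_prod_def inner_outer_prod inner_diff_right inner_commute)
      (simp add: algebra_simps)
  show ?thesis
    unfolding grad_def inner by simp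
qed

text \<open>For fixed \<open>y\<close> the quotient is quadratic in the data, so the expansion is
  exact, with a remainder that is nonnegative and of second order.\<close>

lemma residual_perturbation:
  "(norm (fst p *v y - snd p))\<^sup>2 / (1 + (norm y)\<^sup>2) - (norm (A *v y - b))\<^sup>2 / (1 + (norm y)\<^sup>2)
   = (p - (A, b)) \<bullet> grad y
     + (norm (fst (p - (A, b)) *v y - snd (p - (A, b))))\<^sup>2 / (1 + (norm y)\<^sup>2)"
proof -
  let ?h = "fst (p - (A, b)) *v y - snd (p - (A, b))"
  have "fst p *v y - snd p = (A *v y - b) + ?h"
    by (simp add: fst_diff snd_diff matrix_vector_mult_diff_rdistrib)
  then have "(norm (fst p *v y - snd p))\<^sup>2
      = (norm (A *v y - b))\<^sup>2 + 2 * ((A *v y - b) \<bullet> ?h) + (norm ?h)\<^sup>2"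
    by (simp only: power2_norm_eq_inner inner_add_left inner_add_right inner_commute)
  then show ?thesis
    unfolding inner_grad by (simp add: add_divide_distrib)
qed

text \<open>Envelope argument: \<open>x\<close> is a trial vector for the perturbed data and
  \<open>tls_map p\<close> one for the original data. Up to a second-order term, the two
  inequalities enclose the increment between linear terms whose gradients \<open>grad x\<close> and
  \<open>grad (tls_map p)\<close> agree in the limit.\<close>

lemma has_derivative_least_sv_square:
  "((\<lambda>p. (least_sv p)\<^sup>2) has_derivative (\<lambda>D. D \<bullet> grad x)) (at (A, b))"
proof (rule has_derivativeI_eventually)
  show "bounded_linear (\<lambda>D. D \<bullet> grad x)"
    by (rule bounded_linear_inner_left)
  have "(grad \<longlongrightarrow> grad x) (at x)"
    unfolding grad_def outer_prod_def
    by (intro tendsto_intros tendsto_vec_lambda bounded_linear.tendsto[OF matrix_vector_mul_bounded_linear])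
      (auto simp: add_nonneg_eq_0_iff)
  then have "((\<lambda>p. grad (tls_map p)) \<longlongrightarrow> grad x) (at (A, b))"
    using tendsto_tls_map by (intro isCont_tendsto_compose[of x grad]) (simp add: isCont_def)
  then have "((\<lambda>p. norm (grad (tls_map p) - grad x)) \<longlongrightarrow> 0) (at (A, b))"
    by (intro tendsto_norm_zero) (simp add: LIM_zero_iff)
  moreover have "((\<lambda>p. norm (p - (A, b))) \<longlongrightarrow> 0) (at (A, b))"
    by (auto intro!: tendsto_eq_intros)
  ultimately show "((\<lambda>p. norm (grad (tls_map p) - grad x) + norm (p - (A, b))) \<longlongrightarrow> 0) (at (A, b))"
    by (rule tendsto_add_zero)
  show "\<forall>\<^sub>F p in at (A, b). norm ((least_sv p)\<^sup>2 - (least_sv (A, b))\<^sup>2 - (p - (A, b)) \<bullet> grad x)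
     \<le> (norm (grad (tls_map p) - grad x) + norm (p - (A, b))) * norm (p - (A, b))"
    using eventually_perturbed_solution
  proof eventually_elim
    case (elim p)
    let ?D = "p - (A, b)"
    have pos: "0 < 1 + (norm y)\<^sup>2" for y :: "real^'n"
      by (simp add: add_pos_nonneg)
    have least: "(least_sv q)\<^sup>2 \<le> (norm (fst q *v y - snd q))\<^sup>2 / (1 + (norm y)\<^sup>2)"
      for q :: "(real^'n^'m) \<times> (real^'m)" and y
    proof -
      have "least_sv q * norm (homog y (- 1)) \<le> norm (fst q *v y - snd q)"
        using least_singular_augment_le[OF card, of "fst q" "snd q" y "- 1"] by (simp add: least_sv_def)
      then have "(least_sv q * norm (homog y (- 1)))\<^sup>2 \<le> (norm (fst q *v y - snd q))\<^sup>2"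
        using least_singular_augment_nonneg[OF card, of "fst q" "snd q"]
        by (intro power_mono) (auto simp: least_sv_def)
      then show ?thesis
        using pos[of y] by (simp add: norm_homog power_mult_distrib field_simps)
    qed
    have base: "(least_sv (A, b))\<^sup>2 = (norm (A *v x - b))\<^sup>2 / (1 + (norm x)\<^sup>2)"
      using normal_equations(3) pos[of x] by (simp add: r_def lam_def)
    have pert: "(least_sv p)\<^sup>2 = (norm (fst p *v tls_map p - snd p))\<^sup>2 / (1 + (norm (tls_map p))\<^sup>2)"
      using elim pos[of "tls_map p"] by simp
    have "(norm (fst ?D *v x - snd ?D))\<^sup>2 / (1 + (norm x)\<^sup>2) \<le> (norm ?D)\<^sup>2"
      using norm_perturbed_residual_le[of ?D x] pos[of x] by (simp add: field_simps)
    then have upper: "(least_sv p)\<^sup>2 - (least_sv (A, b))\<^sup>2 - ?D \<bullet> grad x \<le> norm ?D * norm ?D"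
      using least[of p x] residual_perturbation[of p x] base by (simp add: power2_eq_square)
    \<comment> \<open>The lower estimate simply drops the nonnegative remainder.\<close>
    have "0 \<le> (norm (fst ?D *v tls_map p - snd ?D))\<^sup>2 / (1 + (norm (tls_map p))\<^sup>2)"
      by (simp add: add_nonneg_nonneg)
    then have "?D \<bullet> grad (tls_map p) \<le> (least_sv p)\<^sup>2 - (least_sv (A, b))\<^sup>2"
      using least[of "(A, b)" "tls_map p", unfolded fst_conv snd_conv]
        residual_perturbation[of p "tls_map p"] pert by linarith
    moreover have "\<bar>?D \<bullet> (grad (tls_map p) - grad x)\<bar> \<le> norm ?D * norm (grad (tls_map p) - grad x)"
      by (rule Cauchy_Schwarz_ineq2)
    ultimately have lower: "- (norm ?D * norm (grad (tls_map p) - grad x))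
        \<le> (least_sv p)\<^sup>2 - (least_sv (A, b))\<^sup>2 - ?D \<bullet> grad x"
      by (simp add: inner_diff_right abs_le_iff)
    have "0 \<le> norm ?D * norm ?D" "0 \<le> norm ?D * norm (grad (tls_map p) - grad x)"
      by simp_all
    with upper lower have "\<bar>(least_sv p)\<^sup>2 - (least_sv (A, b))\<^sup>2 - ?D \<bullet> grad x\<bar>
        \<le> norm ?D * norm (grad (tls_map p) - grad x) + norm ?D * norm ?D"
      by linarith
    then show ?case
      by (simp only: real_norm_def distrib_left mult.commute)
  qed
qed

section \<open>Derivative of the solution map\<close>

definition \<rho>' where
  "\<rho>' D = (D \<bullet> grad x) *\<^sub>R x - (transpose (fst D) *v r + transpose A *v (fst D *v x - snd D))"

lemma has_derivative_\<rho>: "(\<rho> has_derivative \<rho>') (at (A, b))"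
  unfolding \<rho>_def
  by (rule derivative_eq_intros has_derivative_least_sv_square
      bounded_bilinear.FDERIV[OF bounded_bilinear_matrix_vector_mult]
      bounded_linear.has_derivative[OF bounded_linear_transpose] refl)+
    (simp add: fun_eq_iff \<rho>'_def r_def)

text \<open>Implicit differentiation of the normal equations. Freezing the coefficient matrix at
  \<open>M\<close> leaves errors that are \<open>o(1)\<close> times the displacement, which itself
  is \<open>O(norm (p - (A, b)))\<close>; coercivity of \<open>M\<close> turns this into a bound on
  the linearization error.\<close>

lemma has_derivative_tls_map:
  "(tls_map has_derivative (\<lambda>D. matrix_inv M *v \<rho>' D)) (at (A, b))"
proof -
  have bl: "bounded_linear \<rho>'"
    using has_derivative_\<rho> by (rule has_derivative_bounded_linear)
  then have lin: "bounded_linear (\<lambda>D. matrix_inv M *v \<rho>' D)"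
    by (rule bounded_linear_compose[OF matrix_vector_mul_bounded_linear])
  obtain k where k: "\<And>D. norm (\<rho>' D) \<le> norm D * k"
    using bl bounded_linear.bounded by blast
  \<comment> \<open>\<open>\<eta>\<close> is the relative linearization error of
    \<open>\<rho>\<close>. With \<open>A' = fst p\<close>, \<open>\<mu>\<close> bounds the distance
    of the perturbed coefficient matrix from \<open>M\<close>, through \<open>A'\<^sup>T A' -
    A\<^sup>T A = A'\<^sup>T (A' - A) + (A' - A)\<^sup>T A\<close>.\<close>
  define \<eta> where "\<eta> p = norm (\<rho> p - \<rho> (A, b) - \<rho>' (p - (A, b))) / norm (p - (A, b))" for p
  define \<mu> where "\<mu> p = norm (fst p) * norm (fst p - A) + norm (fst p - A) * norm A
      + \<bar>(least_sv p)\<^sup>2 - lam\<bar>" for p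
  have \<eta>: "(\<eta> \<longlongrightarrow> 0) (at (A, b))"
    using has_derivative_\<rho> unfolding \<eta>_def has_derivative_iff_norm by blast
  have "(fst \<longlongrightarrow> A) (at (A, b))"
    by (rule tendsto_eq_rhs[OF tendsto_fst[OF tendsto_ident_at]]) simp
  then have "(\<mu> \<longlongrightarrow> norm A * norm (A - A) + norm (A - A) * norm A + \<bar>lam - lam\<bar>) (at (A, b))"
    unfolding \<mu>_def by (intro tendsto_intros tendsto_least_sv)
  then have \<mu>: "(\<mu> \<longlongrightarrow> 0) (at (A, b))"
    by simp
  \<comment> \<open>\<open>1 / c\<close> stems from inverting \<open>M\<close>, \<open>2 / c\<close>
    from the a priori bound on the displacement.\<close>
  have "((\<lambda>p. (1 / c) * (\<eta> p + \<mu> p * ((2 / c) * (\<eta> p + k))))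
      \<longlongrightarrow> (1 / c) * (0 + 0 * ((2 / c) * (0 + k)))) (at (A, b))"
    by (intro tendsto_intros \<eta> \<mu>)
  then have lim: "((\<lambda>p. (1 / c) * (\<eta> p + \<mu> p * ((2 / c) * (\<eta> p + k)))) \<longlongrightarrow> 0) (at (A, b))"
    by simp
  have "\<forall>\<^sub>F p in at (A, b). norm (tls_map p - tls_map (A, b) - matrix_inv M *v \<rho>' (p - (A, b)))
     \<le> (1 / c) * (\<eta> p + \<mu> p * ((2 / c) * (\<eta> p + k))) * norm (p - (A, b))"
    using eventually_perturbed_solution eventually_neq_at_within[of "(A, b)" "(A, b)" UNIV]
  proof eventually_elim
    case (elim p)
    let ?D = "p - (A, b)" and ?e = "tls_map p - x"
    let ?z = "?e - matrix_inv M *v \<rho>' ?D"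
    have D: "norm ?D > 0" using elim by simp
    have \<rho>_lin: "norm (\<rho> p - \<rho>' ?D) = \<eta> p * norm ?D"
      using D by (simp add: \<eta>_def \<rho>_zero)
    have "norm (\<rho> p) \<le> norm (\<rho> p - \<rho>' ?D) + norm (\<rho>' ?D)"
      by (metis diff_add_cancel norm_triangle_ineq)
    also have "\<dots> \<le> (\<eta> p + k) * norm ?D"
      using k[of ?D] \<rho>_lin by (simp add: algebra_simps)
    finally have "c / 2 * norm ?e \<le> (\<eta> p + k) * norm ?D"
      using elim by linarith
    then have e_le: "norm ?e \<le> (2 / c) * (\<eta> p + k) * norm ?D"
      using c_pos by (simp add: field_simps)
    define E1 where "E1 = transpose (fst p) *v ((fst p - A) *v ?e)"
    define E2 where "E2 = transpose (fst p - A) *v (A *v ?e)"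
    define E3 where "E3 = ((least_sv p)\<^sup>2 - lam) *\<^sub>R ?e"
    have T: "transpose (fst p - A) = transpose (fst p) - transpose A"
      by (simp add: transpose_def vec_eq_iff)
    have "M *v ?e = \<rho> p - (E1 + E2 - E3)"
      using elim unfolding M_mult E1_def E2_def E3_def T by (simp add: algebra_simps)
    then have "M *v ?z = (\<rho> p - \<rho>' ?D) - (E1 + E2 - E3)"
      by (simp add: matrix_vector_mult_diff_distrib M_inv)
    then have "c * norm ?z \<le> norm ((\<rho> p - \<rho>' ?D) - (E1 + E2 - E3))"
      using M_coercive[of ?z] by simp
    also have "\<dots> \<le> norm (\<rho> p - \<rho>' ?D) + (norm E1 + norm E2 + norm E3)"
      by norm
    also have "norm E1 \<le> norm (fst p) * (norm (fst p - A) * norm ?e)"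
      unfolding E1_def
      by (rule order_trans[OF norm_matrix_vector_mult_le])
        (simp add: norm_transpose mult_left_mono norm_matrix_vector_mult_le)
    also have "norm E2 \<le> norm (fst p - A) * (norm A * norm ?e)"
      unfolding E2_def
      by (rule order_trans[OF norm_matrix_vector_mult_le])
        (simp add: norm_transpose mult_left_mono norm_matrix_vector_mult_le)
    also have "norm E3 = \<bar>(least_sv p)\<^sup>2 - lam\<bar> * norm ?e"
      by (simp add: E3_def)
    finally have "c * norm ?z \<le> \<eta> p * norm ?D + \<mu> p * norm ?e"
      by (simp add: \<rho>_lin \<mu>_def algebra_simps)
    also have "\<dots> \<le> \<eta> p * norm ?D + \<mu> p * ((2 / c) * (\<eta> p + k) * norm ?D)"
      using e_le by (intro add_left_mono mult_left_mono) (simp_all add: \<mu>_def)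
    finally have "norm ?z \<le> (1 / c) * (\<eta> p * norm ?D + \<mu> p * ((2 / c) * (\<eta> p + k) * norm ?D))"
      using c_pos by (simp add: field_simps)
    then show ?case
      by (simp add: x_def algebra_simps)
  qed
  with lin lim show ?thesis
    by (intro has_derivativeI_eventually)
qed

end

section \<open>The norm of the derivative\<close>

text \<open>The factor is the value at \<open>t = s\<^sup>2\<close> of the decreasing function
  \<open>(t + l) / (t - l)\<^sup>2\<close>. No eigenbasis is used: Cauchy-Schwarz yields
  \<open>norm p \<le> g / d\<close> and bounds the form with \<open>- l\<close> by
  \<open>g * (g / d)\<close>; adding \<open>2 * l * (norm p)\<^sup>2\<close> supplies the
  rest.\<close>

lemma gram_shift_norm_bound:
  fixes N :: "real^'k^'m"
  assumes lower: "s * norm p \<le> norm (N *v p)" and "0 \<le> s" and l: "0 \<le> l" "l < s\<^sup>2"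
  shows "(norm (N *v p))\<^sup>2 + l * (norm p)\<^sup>2
    \<le> (s\<^sup>2 + l) / (s\<^sup>2 - l)\<^sup>2 * (norm (transpose N ** N *v p - l *\<^sub>R p))\<^sup>2"
proof -
  define d where "d = s\<^sup>2 - l"
  define g where "g = norm (transpose N ** N *v p - l *\<^sub>R p)"
  have d: "d > 0" using l by (simp add: d_def)
  have "(s * norm p)\<^sup>2 \<le> (norm (N *v p))\<^sup>2"
    using lower \<open>0 \<le> s\<close> by (intro power_mono) auto
  then have "d * norm p \<le> g"
    using shifted_gram_coercive[OF d, of p N l]
    by (simp add: d_def g_def power_mult_distrib algebra_simps flip: matrix_vector_mul_assoc)
  then have p_le: "norm p \<le> g / d"
    using d by (simp add: field_simps)
  have "(norm (N *v p))\<^sup>2 - l * (norm p)\<^sup>2 = (transpose N ** N *v p - l *\<^sub>R p) \<bullet> p"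
    by (simp add: inner_diff_left inner_gram power2_norm_eq_inner)
  also have "\<dots> \<le> g * norm p"
    unfolding g_def by (rule norm_cauchy_schwarz)
  also have "\<dots> \<le> g * (g / d)"
    using p_le by (intro mult_left_mono) (auto simp: g_def)
  finally have 1: "(norm (N *v p))\<^sup>2 - l * (norm p)\<^sup>2 \<le> g * (g / d)" .
  have "(norm p)\<^sup>2 \<le> (g / d)\<^sup>2"
    using p_le by (intro power_mono) auto
  then have "l * (norm p)\<^sup>2 \<le> l * (g / d)\<^sup>2"
    using l by (intro mult_left_mono)
  with 1 have "(norm (N *v p))\<^sup>2 + l * (norm p)\<^sup>2 \<le> g * (g / d) + 2 * (l * (g / d)\<^sup>2)"
    by linarith
  also have "\<dots> = (d + 2 * l) / d\<^sup>2 * g\<^sup>2"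
    using d by (simp add: field_simps power2_eq_square)
  finally show ?thesis
    by (simp add: d_def g_def add.commute)
qed

context tls_gap
begin

section \<open>The two least singular values of \<open>[A b]\<close>\<close>

abbreviation C where "C \<equiv> augment A b"
definition v where "v = homog x (- 1)"
definition a2 where "a2 = 1 + (norm x)\<^sup>2" \<comment> \<open>\<open>\<alpha>\<^sup>-\<^sup>2\<close>\<close>
definition s where "s = singular_value (augment A b) CARD('n)"

lemma a2_pos: "0 < a2"
  by (simp add: a2_def add_pos_nonneg)

lemma norm_v: "v \<bullet> v = a2"
  by (simp add: v_def a2_def inner_homog power2_norm_eq_inner)

lemma gram_v: "transpose C ** C *v v = lam *\<^sub>R v"
  using normal_equations(1,2) by (simp add: v_def gram_augment_mult_homog scaleR_homog r_def)

text \<open>A combination of \<open>y\<close> and \<open>v\<close> with last component 0 would contradict the gap unless it vanishes.\<close>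

lemma gram_eigenvector_parallel:
  assumes "transpose C ** C *v y = lam *\<^sub>R y"
  obtains t where "y = t *\<^sub>R v"
proof -
  obtain u t where y: "y = homog u t" by (rule homog_cases)
  have eq: "transpose C ** C *v (y + t *\<^sub>R v) = lam *\<^sub>R (y + t *\<^sub>R v)"
    by (simp add: matrix_vector_right_distrib matrix_vector_mult_scaleR assms gram_v scaleR_right_distrib)
  have yv: "y + t *\<^sub>R v = homog (u + t *\<^sub>R x) 0"
    by (simp add: y v_def scaleR_homog add_homog)
  have "(norm (A *v (u + t *\<^sub>R x)))\<^sup>2 = lam * (norm (u + t *\<^sub>R x))\<^sup>2"
    using arg_cong[OF eq[unfolded yv], of "\<lambda>z. z \<bullet> homog (u + t *\<^sub>R x) 0"]
    unfolding inner_gram augment_mult_homog by (simp add: inner_homog power2_norm_eq_inner)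
  then have "u + t *\<^sub>R x = 0"
    using gap' by (metis less_irrefl)
  then have "y = (- t) *\<^sub>R v"
    using yv by (simp add: eq_neg_iff_add_eq_0)
  with that show ?thesis by blast
qed

text \<open>\<open>singular_value_last\<close> speaks of some unit eigenvector \<open>v'\<close> for
  \<open>lam\<close>; simplicity of \<open>lam\<close> makes it a multiple of \<open>v\<close>, so
  both have the same orthogonal complement. If \<open>s\<^sup>2\<close> equalled \<open>lam\<close>,
  its eigenvector would be both parallel and orthogonal to \<open>v\<close>.\<close>

lemma second_singular:
  shows s_lower: "v \<bullet> y = 0 \<Longrightarrow> s * norm y \<le> norm (C *v y)"
    and s_eigenvector: "\<exists>y. norm y = 1 \<and> v \<bullet> y = 0 \<and> transpose C ** C *v y = s\<^sup>2 *\<^sub>R y"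
    and s_nonneg: "0 \<le> s"
    and lam_less: "lam < s\<^sup>2"
proof -
  have le: "CARD('n option) \<le> CARD('m)"
    using card by simp
  have suc: "CARD('n option) = CARD('n) + 1" "CARD('n) + 1 - 1 = CARD('n)"
    by simp_all
  have two: "2 \<le> CARD('n) + 1"
    by simp
  have lsv: "singular_value C (CARD('n) + 1) = least_sv (A, b)"
    by (simp add: least_sv_def)
  obtain v' where v': "norm v' = 1" "transpose C ** C *v v' = lam *\<^sub>R v'"
      "0 \<le> least_sv (A, b)" "least_sv (A, b) \<le> s"
      "\<exists>y. norm y = 1 \<and> v' \<bullet> y = 0 \<and> transpose C ** C *v y = s\<^sup>2 *\<^sub>R y"
      "\<And>y. v' \<bullet> y = 0 \<Longrightarrow> s * norm y \<le> norm (C *v y)"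
    by (rule singular_value_last[OF le, of C, unfolded suc lsv, folded s_def lam_def])
      (rule that; use two in blast)
  from gram_eigenvector_parallel[OF v'(2)] obtain t where t: "v' = t *\<^sub>R v" .
  have "t \<noteq> 0" using v'(1) t by auto
  then have orth: "v' \<bullet> y = 0 \<longleftrightarrow> v \<bullet> y = 0" for y
    by (simp add: t)
  show "s * norm y \<le> norm (C *v y)" if "v \<bullet> y = 0"
    using v'(6) orth that by blast
  show ex: "\<exists>y. norm y = 1 \<and> v \<bullet> y = 0 \<and> transpose C ** C *v y = s\<^sup>2 *\<^sub>R y"
    using v'(5) orth by blast
  show "0 \<le> s" using v'(3,4) by simp
  from ex obtain y where y: "norm y = 1" "v \<bullet> y = 0" "transpose C ** C *v y = s\<^sup>2 *\<^sub>R y"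
    by blast
  have "lam \<le> s\<^sup>2"
    unfolding lam_def using v'(3,4) by (intro power_mono)
  moreover have "lam \<noteq> s\<^sup>2"
  proof
    assume "lam = s\<^sup>2"
    with y(3) obtain k where "y = k *\<^sub>R v"
      using gram_eigenvector_parallel by metis
    then have "y \<bullet> y = 0"
      using y(2) by simp
    with y(1) show False by simp
  qed
  ultimately show "lam < s\<^sup>2" by simp
qed

text \<open>The quantity \<open>s\<^sub>n\<close> of the theorem; in this locale \<open>s\<close>
  stands for \<open>\<sigma>\<^sub>n\<close>.\<close>

definition gap_factor where "gap_factor = sqrt (s\<^sup>2 + lam) / (s\<^sup>2 - lam)"

lemma gap_factor_pos: "0 < gap_factor"
  using lam_less lam_nonneg by (auto simp: gap_factor_def intro!: divide_pos_pos add_pos_nonneg)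

section \<open>The adjoint of the derivative\<close>

definition q where "q u = A *v u - (2 / a2 * (x \<bullet> u)) *\<^sub>R r"

text \<open>The adjoint evaluated at \<open>M *v u\<close> instead of \<open>u\<close>, which
  cancels the inverse in \<open>tls_deriv\<close>; since \<open>M\<close> is invertible, every
  vector is reached.\<close>

definition tls_deriv_adj where "tls_deriv_adj u = - (outer_prod r u + outer_prod (q u) x, - q u)"

definition tls_deriv where "tls_deriv D = matrix_inv M *v \<rho>' D"

text \<open>\<open>M\<close> moves across the inner product and cancels its inverse; the terms in
  \<open>fst D *v x - snd D\<close>, one from \<open>grad x\<close> and one from
  \<open>A *v u\<close>, combine into \<open>q u\<close>.\<close>

lemma tls_deriv_adjoint: "(M *v u) \<bullet> tls_deriv D = D \<bullet> tls_deriv_adj u"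
proof -
  have "(M *v u) \<bullet> tls_deriv D = u \<bullet> \<rho>' D"
    by (simp add: tls_deriv_def M_self_adjoint M_inv)
  also have "\<dots> = (D \<bullet> grad x) * (x \<bullet> u) - (r \<bullet> (fst D *v u) + (A *v u) \<bullet> (fst D *v x - snd D))"
    by (simp add: \<rho>'_def inner_diff_left inner_add_left transpose_mult_inner inner_commute[of u])
       (simp add: inner_commute inner_diff_right algebra_simps)
  also have "D \<bullet> grad x = 2 / a2 * (r \<bullet> (fst D *v x - snd D))"
    by (simp add: inner_grad r_def a2_def)
  also have "2 / a2 * (r \<bullet> (fst D *v x - snd D)) * (x \<bullet> u)
      - (r \<bullet> (fst D *v u) + (A *v u) \<bullet> (fst D *v x - snd D))
      = - (r \<bullet> (fst D *v u)) - q u \<bullet> (fst D *v x - snd D)"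
    unfolding q_def inner_diff_left inner_scaleR_left by (simp add: algebra_simps)
  also have "\<dots> = D \<bullet> tls_deriv_adj u"
    unfolding tls_deriv_adj_def inner_minus_right inner_prod_def fst_uminus snd_uminus fst_conv snd_conv inner_add_right inner_outer_prod
    by (simp add: inner_diff_right inner_commute)
  finally show ?thesis .
qed

text \<open>By the normal equations, \<open>q u\<close> is the reflection of \<open>A *v u\<close>
  in the hyperplane orthogonal to \<open>r\<close> when \<open>r \<noteq> 0\<close>. Hence it has
  the norm of \<open>A *v u\<close> and the opposite inner product with \<open>r\<close>, which
  removes \<open>q\<close> from the expanded square.\<close>

lemma norm_tls_deriv_adj: "(norm (tls_deriv_adj u))\<^sup>2 = a2 * ((norm (A *v u))\<^sup>2 + lam * (norm u)\<^sup>2) - 2 * lam * (x \<bullet> u)\<^sup>2"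
proof -
  have rr: "r \<bullet> r = lam * a2"
    using normal_equations(3) by (simp add: a2_def power2_norm_eq_inner)
  have rA: "r \<bullet> (A *v u) = lam * (x \<bullet> u)"
    using normal_equations(1) by (simp flip: transpose_mult_inner)
  have rq: "r \<bullet> q u = - lam * (x \<bullet> u)"
    using a2_pos by (simp add: q_def inner_diff_right rA rr)
  have "q u \<bullet> q u = (A *v u) \<bullet> q u - (2 / a2 * (x \<bullet> u)) * (r \<bullet> q u)"
    by (subst (1) q_def) (simp add: inner_diff_left)
  also have "(A *v u) \<bullet> q u = (A *v u) \<bullet> (A *v u) - (2 / a2 * (x \<bullet> u)) * (lam * (x \<bullet> u))"
    by (simp add: q_def inner_diff_right inner_commute[of _ r] rA)
  finally have qq: "q u \<bullet> q u = (A *v u) \<bullet> (A *v u)"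
    by (simp add: rq)
  have "(norm (tls_deriv_adj u))\<^sup>2 = (r \<bullet> r) * (u \<bullet> u) + 2 * (r \<bullet> q u) * (x \<bullet> u) + (q u \<bullet> q u) * (1 + x \<bullet> x)"
    unfolding tls_deriv_adj_def norm_minus_cancel
    unfolding power2_norm_eq_inner inner_minus_left inner_minus_right inner_prod_def fst_uminus snd_uminus fst_conv
      snd_conv inner_add_left inner_add_right inner_outer_prod outer_prod_mult inner_scaleR_right
    by (simp add: outer_prod_mult inner_commute algebra_simps)
  then show ?thesis
    unfolding rr rq qq by (simp add: a2_def dot_square_norm power2_eq_square algebra_simps)
qed

section \<open>Projection orthogonal to \<open>v\<close>\<close>

definition proj where "proj u = homog u 0 - ((x \<bullet> u) / a2) *\<^sub>R v"

lemma v_proj: "v \<bullet> proj u = 0"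
  using a2_pos by (simp add: proj_def inner_diff_right norm_v) (simp add: v_def inner_homog)

lemma homog_eq_proj: "homog u 0 = proj u + ((x \<bullet> u) / a2) *\<^sub>R v"
  by (simp add: proj_def)

text \<open>\<open>proj u\<close> and \<open>v\<close> are orthogonal, and so are their images under
  \<open>C\<close>, so both \<open>norm u\<close> and \<open>norm (A *v u)\<close> split by
  Pythagoras; the parts along \<open>v\<close> cancel
  \<open>- 2 * lam * (x \<bullet> u)\<^sup>2\<close>.\<close>

lemma norm_tls_deriv_adj_proj: "(norm (tls_deriv_adj u))\<^sup>2 = a2 * ((norm (C *v proj u))\<^sup>2 + lam * (norm (proj u))\<^sup>2)"
proof -
  let ?k = "(x \<bullet> u) / a2"
  have orth: "(C *v v) \<bullet> (C *v proj u) = 0"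
    using v_proj[of u] by (simp add: inner_gram[symmetric] gram_v)
  have Cv: "(C *v v) \<bullet> (C *v v) = lam * a2"
    by (simp add: inner_gram[symmetric] gram_v norm_v)
  have "(norm u)\<^sup>2 = homog u 0 \<bullet> homog u 0"
    by (simp add: inner_homog power2_norm_eq_inner)
  also have "\<dots> = (norm (proj u))\<^sup>2 + ?k\<^sup>2 * a2"
    unfolding homog_eq_proj using v_proj[of u]
    by (simp add: inner_add_left inner_add_right inner_commute norm_v power2_norm_eq_inner)
      (simp add: power2_eq_square)
  finally have u2: "(norm u)\<^sup>2 = (norm (proj u))\<^sup>2 + ?k\<^sup>2 * a2" .
  have "(norm (A *v u))\<^sup>2 = (C *v homog u 0) \<bullet> (C *v homog u 0)"
    by (simp add: augment_mult_homog power2_norm_eq_inner)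
  also have "\<dots> = (norm (C *v proj u))\<^sup>2 + ?k\<^sup>2 * (lam * a2)"
    unfolding homog_eq_proj matrix_vector_right_distrib matrix_vector_mult_scaleR using orth
    by (simp add: inner_add_left inner_add_right inner_commute Cv power2_norm_eq_inner)
      (simp add: power2_eq_square)
  finally have Au2: "(norm (A *v u))\<^sup>2 = (norm (C *v proj u))\<^sup>2 + ?k\<^sup>2 * (lam * a2)" .
  have xu: "x \<bullet> u = ?k * a2"
    using a2_pos by simp
  show ?thesis
    unfolding norm_tls_deriv_adj u2 Au2 by (subst (3) xu) (simp add: power_mult_distrib algebra_simps power2_eq_square)
qed

text \<open>\<open>v\<close> lies in the kernel of \<open>C\<^sup>T C - lam\<close>, so
  \<open>proj u\<close> may be replaced by \<open>(u, 0)\<close>. The image is orthogonal to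
  \<open>v = (x, - 1)\<close>, which determines its last component.\<close>

lemma gram_shift_proj:
  "transpose C ** C *v proj u - lam *\<^sub>R proj u = homog (M *v u) (x \<bullet> (M *v u))"
proof -
  have "transpose C ** C *v proj u - lam *\<^sub>R proj u = transpose C ** C *v homog u 0 - lam *\<^sub>R homog u 0"
    by (simp add: proj_def matrix_vector_mult_diff_distrib matrix_vector_mult_scaleR gram_v algebra_simps)
  also have "\<dots> = homog (M *v u) (b \<bullet> (A *v u))"
    by (simp add: gram_augment_mult_homog scaleR_homog diff_homog M_mult)
  finally have eq: "transpose C ** C *v proj u - lam *\<^sub>R proj u = homog (M *v u) (b \<bullet> (A *v u))" .
  have "(transpose C ** C *v proj u - lam *\<^sub>R proj u) \<bullet> v = (transpose C ** C *v v - lam *\<^sub>R v) \<bullet> proj u"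
    unfolding inner_diff_left inner_gram by (simp add: inner_commute)
  then have "homog (M *v u) (b \<bullet> (A *v u)) \<bullet> v = 0"
    by (simp add: eq gram_v)
  then show ?thesis
    by (simp add: eq v_def inner_homog inner_commute)
qed

text \<open>One factor \<open>sqrt a2\<close> comes from the norm of the adjoint, the other from
  Cauchy-Schwarz applied to \<open>x \<bullet> (M *v u)\<close>.\<close>

lemma norm_tls_deriv_adj_le: "norm (tls_deriv_adj u) \<le> a2 * gap_factor * norm (M *v u)"
proof -
  have "(norm (tls_deriv_adj u))\<^sup>2 \<le> a2 * ((s\<^sup>2 + lam) / (s\<^sup>2 - lam)\<^sup>2
      * (norm (transpose C ** C *v proj u - lam *\<^sub>R proj u))\<^sup>2)"
    unfolding norm_tls_deriv_adj_proj using a2_pos lam_nonneg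
    by (intro mult_left_mono gram_shift_norm_bound s_lower v_proj s_nonneg lam_less) auto
  also have "(s\<^sup>2 + lam) / (s\<^sup>2 - lam)\<^sup>2 = gap_factor\<^sup>2"
    using lam_nonneg by (simp add: gap_factor_def power_divide)
  also have "(norm (transpose C ** C *v proj u - lam *\<^sub>R proj u))\<^sup>2
      = (norm (M *v u))\<^sup>2 + (x \<bullet> (M *v u))\<^sup>2"
    by (simp add: gram_shift_proj norm_homog)
  also have "a2 * (gap_factor\<^sup>2 * ((norm (M *v u))\<^sup>2 + (x \<bullet> (M *v u))\<^sup>2))
      \<le> a2 * (gap_factor\<^sup>2 * (a2 * (norm (M *v u))\<^sup>2))"
  proof -
    have "\<bar>x \<bullet> (M *v u)\<bar>\<^sup>2 \<le> (norm x * norm (M *v u))\<^sup>2"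
      by (intro power_mono Cauchy_Schwarz_ineq2) simp
    then have "(norm (M *v u))\<^sup>2 + (x \<bullet> (M *v u))\<^sup>2 \<le> a2 * (norm (M *v u))\<^sup>2"
      by (simp add: a2_def power_mult_distrib algebra_simps)
    then show ?thesis
      using a2_pos by (intro mult_left_mono) auto
  qed
  finally have "(norm (tls_deriv_adj u))\<^sup>2 \<le> (a2 * gap_factor * norm (M *v u))\<^sup>2"
    by (simp add: power2_eq_square mult_ac)
  then show ?thesis
    by (rule power2_le_imp_le) (use a2_pos gap_factor_pos in simp)
qed

section \<open>Operator norm of the derivative\<close>

lemma bounded_linear_tls_deriv: "bounded_linear tls_deriv"
  using has_derivative_bounded_linear[OF has_derivative_tls_map] by (simp add: tls_deriv_def[abs_def])

lemma onorm_tls_deriv_le: "onorm tls_deriv \<le> a2 * gap_factor"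
proof (rule onorm_bound)
  show "0 \<le> a2 * gap_factor" using a2_pos gap_factor_pos by simp
  fix D
  \<comment> \<open>Chosen so that the adjoint identity pairs \<open>tls_deriv D\<close> with
    itself, which turns the bound on the adjoint into one on the derivative.\<close>
  define u where "u = matrix_inv M *v tls_deriv D"
  have Mu: "M *v u = tls_deriv D"
    by (simp add: u_def M_inv)
  have "norm (tls_deriv D) * norm (tls_deriv D) = D \<bullet> tls_deriv_adj u"
    using tls_deriv_adjoint[of u D] by (simp add: Mu dot_square_norm power2_eq_square)
  also have "\<dots> \<le> norm D * norm (tls_deriv_adj u)"
    by (rule norm_cauchy_schwarz)
  also have "\<dots> \<le> norm D * (a2 * gap_factor * norm (tls_deriv D))"
    using norm_tls_deriv_adj_le[of u] by (intro mult_left_mono) (auto simp: Mu)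
  finally have "norm (tls_deriv D) * norm (tls_deriv D) \<le> (a2 * gap_factor * norm D) * norm (tls_deriv D)"
    by (simp add: mult_ac)
  then show "norm (tls_deriv D) \<le> a2 * gap_factor * norm D"
    using a2_pos gap_factor_pos by (cases "norm (tls_deriv D) = 0") auto
qed

text \<open>The derivative is tested in the direction \<open>tls_deriv_adj u\<close>, where
  \<open>proj u\<close> is a unit eigenvector for \<open>s\<^sup>2\<close>. The norm of this
  direction is then known exactly, while \<open>M *v u\<close> is the upper part of a vector of norm
  \<open>s\<^sup>2 - lam\<close>.\<close>

lemma onorm_tls_deriv_ge: "sqrt a2 * gap_factor \<le> onorm tls_deriv"
proof -
  from s_eigenvector obtain y where y: "norm y = 1" "v \<bullet> y = 0" "transpose C ** C *v y = s\<^sup>2 *\<^sub>R y"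
    by blast
  obtain g t where g: "y = homog g t" by (rule homog_cases)
  \<comment> \<open>Adding \<open>t *\<^sub>R v\<close> cancels the last component of
    \<open>y\<close>, and the projection undoes the addition.\<close>
  define u where "u = g + t *\<^sub>R x"
  have U: "homog u 0 = y + t *\<^sub>R v"
    by (simp add: u_def g v_def scaleR_homog add_homog)
  have "x \<bullet> u = v \<bullet> homog u 0"
    by (simp add: v_def inner_homog)
  also have "\<dots> = t * a2"
    unfolding U by (simp add: inner_add_right y norm_v)
  finally have proj: "proj u = y"
    using a2_pos by (simp add: proj_def U)
  have "(norm (C *v y))\<^sup>2 = s\<^sup>2"
    using y(1) by (simp add: power2_norm_eq_inner inner_gram[symmetric] y(3)) (simp add: norm_eq_1)
  then have T2: "(norm (tls_deriv_adj u))\<^sup>2 = a2 * (s\<^sup>2 + lam)"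
    unfolding norm_tls_deriv_adj_proj proj by (simp add: y)
  then have T: "norm (tls_deriv_adj u) = sqrt a2 * sqrt (s\<^sup>2 + lam)"
    by (metis norm_ge_zero real_sqrt_mult real_sqrt_unique)
  have Tpos: "norm (tls_deriv_adj u) > 0"
    unfolding T using a2_pos lam_less lam_nonneg by simp
  have "homog (M *v u) (x \<bullet> (M *v u)) = (s\<^sup>2 - lam) *\<^sub>R y"
    using gram_shift_proj[of u] by (simp add: proj y algebra_simps)
  then have "norm (homog (M *v u) (x \<bullet> (M *v u))) = s\<^sup>2 - lam"
    using lam_less by (simp add: y)
  moreover have "norm (M *v u) \<le> norm (homog (M *v u) (x \<bullet> (M *v u)))"
    by (simp add: norm_homog real_le_rsqrt)
  ultimately have Mu: "norm (M *v u) \<le> s\<^sup>2 - lam"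
    by simp
  have "norm (tls_deriv_adj u) * norm (tls_deriv_adj u) = (M *v u) \<bullet> tls_deriv (tls_deriv_adj u)"
    by (simp add: tls_deriv_adjoint dot_square_norm power2_eq_square)
  also have "\<dots> \<le> norm (M *v u) * norm (tls_deriv (tls_deriv_adj u))"
    by (rule norm_cauchy_schwarz)
  also have "\<dots> \<le> (s\<^sup>2 - lam) * (onorm tls_deriv * norm (tls_deriv_adj u))"
    using Mu lam_less by (intro mult_mono onorm[OF bounded_linear_tls_deriv]) auto
  finally have "norm (tls_deriv_adj u) \<le> (s\<^sup>2 - lam) * onorm tls_deriv"
    using Tpos by simp
  then show ?thesis
    using lam_less by (simp add: T gap_factor_def field_simps)
qed

end

text \<open>Differentiability belongs to the conclusion because it makes the
  \<open>frechet_derivative\<close> in \<open>tls_cond\<close> a genuine derivative.\<close>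

theorem mainTheorem4:
  fixes A :: "real^'n^'m" and b :: "real^'m" and x :: "real^'n"
    and \<alpha> s \<kappa>_lower \<kappa>_upper :: real
  assumes "CARD('m) > CARD('n)"
    and "0 < singular_value (augment A b) (CARD('n) + 1)"
    and "singular_value (augment A b) (CARD('n) + 1) < singular_value A (CARD('n))"
    and "tls_solution A b x"
    and "\<alpha> = 1 / sqrt (1 + (norm x)\<^sup>2)"
    and "s = sqrt ((singular_value (augment A b) (CARD('n)))\<^sup>2
                   + (singular_value (augment A b) (CARD('n) + 1))\<^sup>2)
             / ((singular_value (augment A b) (CARD('n)))\<^sup>2
                - (singular_value (augment A b) (CARD('n) + 1))\<^sup>2)"
    and "\<kappa>_lower = inverse \<alpha> * s"
    and "\<kappa>_upper = inverse (\<alpha>\<^sup>2) * s"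
  shows "tls_map differentiable (at (A, b))
    \<and> \<kappa>_lower \<le> tls_cond A b \<and> tls_cond A b \<le> \<kappa>_upper
    \<and> (1 / 2 < \<alpha> \<and> \<alpha> < 1 \<longrightarrow> \<kappa>_lower < \<kappa>_upper \<and> \<kappa>_upper < 4 * \<kappa>_lower)"
proof -
  define \<sigma> where "\<sigma> = least_sv (A, b)"
  have \<sigma>: "singular_value (augment A b) (CARD('n) + 1) = \<sigma>"
    by (simp add: \<sigma>_def least_sv_def)
  define c where "c = (singular_value A CARD('n))\<^sup>2 - \<sigma>\<^sup>2"
  have c: "0 < c"
    using assms(2,3) unfolding c_def \<sigma> by (simp add: power_strict_mono)
  interpret tls_gap A b c
  proof
    show "CARD('n) < CARD('m)" by fact
    show "0 < c" by fact
    show "((least_sv (A, b))\<^sup>2 + c) * (norm u)\<^sup>2 \<le> (norm (A *v u))\<^sup>2" for u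
    proof -
      have "singular_value A CARD('n) * norm u \<le> norm (A *v u)"
        by (rule singular_value_last[of A]) (use assms(1) in auto)
      then have "(singular_value A CARD('n) * norm u)\<^sup>2 \<le> (norm (A *v u))\<^sup>2"
        using assms(2,3) by (intro power_mono) auto
      then show ?thesis
        by (simp add: c_def power_mult_distrib flip: \<sigma>_def)
    qed
  qed
  \<comment> \<open>\<open>tls_gap.x A b\<close> is the solution \<open>tls_map (A, b)\<close> of
    the locale, whose short name is taken here by the given TLS solution.\<close>
  have x: "x = tls_gap.x A b"
    unfolding x_def using assms(1,4) gap'
    by (intro tls_solution_eq_tls_map) (simp_all add: lam_def least_sv_def)
  have s: "s = gap_factor"
    by (simp add: assms(6) gap_factor_def s_def lam_def least_sv_def)
  have \<alpha>: "inverse \<alpha> = sqrt a2" "inverse (\<alpha>\<^sup>2) = a2" "0 < \<alpha>"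
    using a2_pos by (simp_all add: assms(5) a2_def x power_divide)
  have cond: "tls_cond A b = onorm tls_deriv"
    unfolding tls_cond_def using frechet_derivative_at[OF has_derivative_tls_map]
    by (simp add: tls_deriv_def[abs_def])
  have "tls_map differentiable (at (A, b))"
    using has_derivative_tls_map by (rule differentiableI)
  moreover have "\<kappa>_lower \<le> tls_cond A b" "tls_cond A b \<le> \<kappa>_upper"
    using onorm_tls_deriv_ge onorm_tls_deriv_le by (simp_all add: assms(7,8) \<alpha> s cond)
  moreover have "\<kappa>_lower < \<kappa>_upper \<and> \<kappa>_upper < 4 * \<kappa>_lower" if "1 / 2 < \<alpha>" "\<alpha> < 1"
  proof -
    \<comment> \<open>The two bounds differ by the factor \<open>inverse \<alpha>\<close>, which
      lies between 1 and 2 here.\<close>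
    have inv: "1 < inverse \<alpha>" "inverse \<alpha> < 4"
      using that \<alpha>(3) by (auto simp: field_simps)
    have up: "\<kappa>_upper = inverse \<alpha> * \<kappa>_lower"
      by (simp add: assms(7,8) power2_eq_square)
    have "0 < \<kappa>_lower"
      using gap_factor_pos \<alpha>(3) by (simp add: assms(7) s)
    then show ?thesis
      using inv by (simp add: up)
  qed
  ultimately show ?thesis by blast
qed

end
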